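(* Let $X=\{X_1,\dots,X_n\}$ be a set of $n$ continuous real-valued random variables and let $Y$ be a discrete random variable taking values in $\{1,\dots,c\}$, all defined on a common probability space. Let $\mathbb{S}\subseteq\{1,\dots,n\}$ be a subset of $k$ indices, $1\le k\le n$, let $i\in\mathbb{S}$, and put $\mathbb{S}_i=\mathbb{S}\setminus\{i\}$. Assume that the features $X_j$, $j\in\mathbb{S}_i$, are conditionally independent given $X_i$ and class-conditionally independent given $X_i$, i.e. $$p(X_{\mathbb{S}_i}\mid X_i)=\prod_{j\in\mathbb{S}_i}p(X_j\mid X_i)\qquad\text{and}\qquad p(X_{\mathbb{S}_i}\mid X_i,Y)=\prod_{j\in\mathbb{S}_i}p(X_j\mid X_i,Y).$$ Then $$I(X_{\mathbb{S}};Y)=I(X_i;Y)+\sum_{j\in\mathbb{S}_i}I(X_j;Y\mid X_i).$$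
   Context: For an index set $\mathbb{T}$, $X_{\mathbb{T}}$ denotes the random vector $(X_j)_{j\in\mathbb{T}}$. $p(\cdot\mid\cdot)$ denotes conditional distributions; the two product formulas say that the family $(X_j)_{j\in\mathbb{S}_i}$ is mutually conditionally independent given $X_i$, and mutually conditionally independent given the pair $(X_i,Y)$. $I(A;B)$ denotes the mutual information between random vectors $A$ and $B$, i.e. the Kullback–Leibler divergence of the joint law of $(A,B)$ from the product of the marginal laws; equivalently $I(A;B)=H(A)-H(A\mid B)$, with $H$ the entropy, when the entropies are defined and finite. $I(A;B\mid C)$ denotes the conditional mutual information, i.e. the expected value over $C$ of the mutual information of $A$ and $B$ under their conditional joint law given $C$. *)

theory Defs
  imports "HOL-Probability.Probability"
begin

text \<open>
  \<open>cond_law M N Z U C K\<close>: the Markov kernel \<open>K\<close> from \<open>U\<close> to \<open>N\<close> is a version of the regular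
  conditional distribution of \<open>Z\<close> given \<open>C\<close> under the probability measure \<open>M\<close>.
\<close>

definition cond_law ::
  "'a measure \<Rightarrow> 'b measure \<Rightarrow> ('a \<Rightarrow> 'b) \<Rightarrow> 'c measure \<Rightarrow> ('a \<Rightarrow> 'c) \<Rightarrow> ('c \<Rightarrow> 'b measure) \<Rightarrow> bool"
  where
  "cond_law M N Z U C K \<longleftrightarrow>
     K \<in> measurable U (prob_algebra N) \<and>
     (\<forall>A\<in>sets U. \<forall>B\<in>sets N.
        emeasure M {\<omega> \<in> space M. C \<omega> \<in> A \<and> Z \<omega> \<in> B}
          = (\<integral>\<^sup>+c\<in>A. emeasure (K c) B \<partial>distr M U C))"

text \<open>
  Mutual conditional independence of a finite family \<open>(X j)\<close>, \<open>j \<in> J\<close>, given \<open>C\<close>: the product of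
  the conditional distributions of the \<open>X j\<close> is a conditional distribution of the whole vector.
  Versions are unique almost everywhere if the \<open>N j\<close> are countably generated, and then the choice
  of \<open>K\<close> is immaterial.
\<close>

definition cond_indep_vars ::
  "'a measure \<Rightarrow> ('i \<Rightarrow> 'b measure) \<Rightarrow> ('i \<Rightarrow> 'a \<Rightarrow> 'b) \<Rightarrow> 'i set \<Rightarrow> 'c measure \<Rightarrow> ('a \<Rightarrow> 'c) \<Rightarrow> bool"
  where
  "cond_indep_vars M N X J U C \<longleftrightarrow>
     (\<exists>K. (\<forall>j\<in>J. cond_law M (N j) (X j) U C (K j)) \<and>
          cond_law M (PiM J N) (\<lambda>\<omega>. \<lambda>j\<in>J. X j \<omega>) U C (\<lambda>c. PiM J (\<lambda>j. K j c)))"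

text \<open>
  Conditional mutual information \<open>I(A; B | C)\<close>, to base \<open>b\<close>: the expected value over \<open>C\<close> of the
  mutual information of the two coordinates under the conditional joint law of \<open>(A, B)\<close> given \<open>C\<close>.
  A conditional law exists on standard Borel spaces and the value does not depend on the version
  chosen. The integrand is nonnegative, so its expectation is taken as a nonnegative Lebesgue
  integral. As for the real-valued \<^const>\<open>KL_divergence\<close>, the value is only meaningful
  when the divergences involved are finite, e.g. when \<open>B\<close> takes finitely many values.
\<close>

definition cond_mutual_info ::
  "real \<Rightarrow> 'a measure \<Rightarrow> 'b measure \<Rightarrow> 'c measure \<Rightarrow> 'd measure
     \<Rightarrow> ('a \<Rightarrow> 'b) \<Rightarrow> ('a \<Rightarrow> 'c) \<Rightarrow> ('a \<Rightarrow> 'd) \<Rightarrow> real"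
  where
  "cond_mutual_info b M S T U A B C =
     (let K = (SOME K. cond_law M (S \<Otimes>\<^sub>M T) (\<lambda>\<omega>. (A \<omega>, B \<omega>)) U C K) in
        enn2real (\<integral>\<^sup>+c. ennreal (prob_space.mutual_information (K c) b S T fst snd) \<partial>distr M U C))"

end

theory Submission
  imports Defs
begin

text \<open>
  Since \<open>Y\<close> takes finitely many values, \<open>I(Z; Y)\<close> is the expectation of
  \<open>log (P(Y | Z) / P(Y))\<close> and \<open>I(A; Y | C)\<close> that of \<open>log (P(Y | C, A) / P(Y | C))\<close>; both are
  finite because \<open>t log t\<close> is bounded on \<open>[0, 1]\<close>. The two conditional independence assumptions and
  Bayes' rule give, almost surely,
  \<open>P(Y | X\<^sub>S) / P(Y | X\<^sub>i) = (\<Prod>j. P(Y | X\<^sub>i, X\<^sub>j) / P(Y | X\<^sub>i))\<close>,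
  and the theorem follows by taking logarithms and expectations.
\<close>

section \<open>Posterior class probabilities\<close>

text \<open>The features need not have a joint density, so the usual densities are replaced by
  Radon-Nikodym derivatives of the finitely many events \<open>Y = y\<close>, which exist relative
  to the law of any observed vector. Relative to its own law the vector has density 1, so densities
  of the features never appear.

  The two independence hypotheses act at opposite ends. The class-conditional one splits the
  probability of a box within a class into factors; Bayes' rule rewrites each factor as an integral
  against the law of \<open>X j\<close> given \<open>X i\<close>; independence given
  \<open>X i\<close> alone folds the product of these integrals into one integral over the joint
  law.

  Two features of the definitions shape the rest. Mutual information is a Bochner integral with
  default value 0, so it can be split into summands only once integrability is known. Conditional
  mutual information selects a kernel by \<open>SOME\<close>, so a joint conditional law must be
  exhibited (the class-conditional kernels supply it) and the value must be computed for an
  arbitrary version.\<close>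

definition posterior ::
  "'a measure \<Rightarrow> 'b measure \<Rightarrow> ('a \<Rightarrow> 'b) \<Rightarrow> 'd set \<Rightarrow> ('a \<Rightarrow> 'd) \<Rightarrow> ('d \<Rightarrow> 'b \<Rightarrow> real) \<Rightarrow> bool"
  where
  "posterior M N Z T Y q \<longleftrightarrow>
     (\<forall>y\<in>T. q y \<in> borel_measurable N \<and> (\<forall>z. 0 \<le> q y z) \<and>
       (\<forall>B\<in>sets N. emeasure M {\<omega> \<in> space M. Z \<omega> \<in> B \<and> Y \<omega> = y}
          = (\<integral>\<^sup>+z\<in>B. ennreal (q y z) \<partial>distr M N Z)))"

lemma posteriorD:
  assumes "posterior M N Z T Y q" "y \<in> T"
  shows "q y \<in> borel_measurable N" "0 \<le> q y z"
    and "B \<in> sets N \<Longrightarrow> emeasure M {\<omega> \<in> space M. Z \<omega> \<in> B \<and> Y \<omega> = y}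
          = (\<integral>\<^sup>+z\<in>B. ennreal (q y z) \<partial>distr M N Z)"
  using assms by (auto simp: posterior_def)

lemma sets_eq_count_space:
  assumes "Y \<in> measurable M (count_space T)"
  shows "{\<omega> \<in> space M. Y \<omega> = y} \<in> sets M"
proof -
  have "{\<omega> \<in> space M. Y \<omega> = y} = Y -` ({y} \<inter> T) \<inter> space M"
    using measurable_space[OF assms] by auto
  also have "\<dots> \<in> sets M"
    by (rule measurable_sets[OF assms]) auto
  finally show ?thesis .
qed

lemma emeasure_partition_finite:
  assumes Y: "Y \<in> measurable M (count_space T)" and "finite T"
    and A: "{\<omega> \<in> space M. P \<omega>} \<in> sets M"
  shows "emeasure M {\<omega> \<in> space M. P \<omega>} = (\<Sum>y\<in>T. emeasure M {\<omega> \<in> space M. P \<omega> \<and> Y \<omega> = y})"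
proof -
  have "{\<omega> \<in> space M. P \<omega> \<and> Y \<omega> = y} \<in> sets M" for y
    using sets.Int[OF A sets_eq_count_space[OF Y, of y]]
    by (rule back_subst[where P="\<lambda>A. A \<in> sets M"]) auto
  then have "(\<Sum>y\<in>T. emeasure M {\<omega> \<in> space M. P \<omega> \<and> Y \<omega> = y})
      = emeasure M (\<Union>y\<in>T. {\<omega> \<in> space M. P \<omega> \<and> Y \<omega> = y})"
    by (intro sum_emeasure \<open>finite T\<close>) (auto simp: disjoint_family_on_def)
  also have "(\<Union>y\<in>T. {\<omega> \<in> space M. P \<omega> \<and> Y \<omega> = y}) = {\<omega> \<in> space M. P \<omega>}"
    using measurable_space[OF Y] by auto
  finally show ?thesis ..
qed

text \<open>Restricting \<open>M\<close> to \<open>E\<close> and pushing forward along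
  \<open>Z\<close> makes \<open>P(Z in B, E)\<close> a measure in \<open>B\<close>, so that
  Radon-Nikodym and uniqueness on generators apply to it.\<close>

lemma emeasure_distr_restricted:
  assumes Z[measurable]: "Z \<in> measurable M N" and E[measurable]: "E \<in> sets M" and B[measurable]: "B \<in> sets N"
  shows "emeasure (distr (density M (indicator E)) N Z) B = emeasure M {\<omega> \<in> space M. Z \<omega> \<in> B \<and> \<omega> \<in> E}"
proof -
  have "emeasure (distr (density M (indicator E)) N Z) B = emeasure (density M (indicator E)) (Z -` B \<inter> space M)"
    by (subst emeasure_distr) auto
  also have "\<dots> = emeasure M (E \<inter> (Z -` B \<inter> space M))"
    by (subst emeasure_density) (auto simp: nn_integral_indicator[symmetric] indicator_inter_arith
        simp del: nn_integral_indicator intro!: nn_integral_cong)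
  also have "E \<inter> (Z -` B \<inter> space M) = {\<omega> \<in> space M. Z \<omega> \<in> B \<and> \<omega> \<in> E}"
    by auto
  finally show ?thesis .
qed

text \<open>\<open>P(Z in B, Y = y)\<close> is at most \<open>P(Z in B)\<close>, so as a measure in
  \<open>B\<close> it has a Radon-Nikodym derivative with respect to the law of \<open>Z\<close>. A
  version that is real and nonnegative at every point is kept, so that products and quotients of
  posteriors stay nonnegative everywhere.\<close>

lemma posterior_exists:
  assumes "prob_space M" and Z[measurable]: "Z \<in> measurable M N"
    and Y: "Y \<in> measurable M (count_space T)"
  obtains q where "posterior M N Z T Y q"
proof -
  interpret prob_space M by fact
  interpret Z: prob_space "distr M N Z" by (rule prob_space_distr) fact
  have "\<exists>f. f \<in> borel_measurable N \<and> (\<forall>z. 0 \<le> f z) \<and>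
     (\<forall>B\<in>sets N. emeasure M {\<omega> \<in> space M. Z \<omega> \<in> B \<and> Y \<omega> = y}
          = (\<integral>\<^sup>+z\<in>B. ennreal (f z) \<partial>distr M N Z))" if "y \<in> T" for y
  proof -
    define E where "E = {\<omega> \<in> space M. Y \<omega> = y}"
    have E[measurable]: "E \<in> sets M" unfolding E_def by (rule sets_eq_count_space[OF Y])
    define \<nu> where "\<nu> = distr (density M (indicator E)) N Z"
    have \<nu>: "emeasure \<nu> B = emeasure M {\<omega> \<in> space M. Z \<omega> \<in> B \<and> Y \<omega> = y}" if "B \<in> sets N" for B
      unfolding \<nu>_def by (subst emeasure_distr_restricted[OF Z E that]) (auto simp: E_def intro!: arg_cong[where f="emeasure M"])
    have fin: "finite_measure \<nu>"
      by (rule finite_measureI) (simp add: \<nu> \<nu>_def[THEN arg_cong[where f=space]])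
    have "absolutely_continuous (distr M N Z) \<nu>"
    proof (unfold absolutely_continuous_def, safe)
      fix B assume "B \<in> null_sets (distr M N Z)"
      then have [measurable]: "B \<in> sets N" and 0: "emeasure M (Z -` B \<inter> space M) = 0"
        by (auto simp: null_sets_distr_iff emeasure_distr null_setsD1)
      have "emeasure \<nu> B \<le> emeasure M (Z -` B \<inter> space M)"
        by (subst \<nu>) (auto intro!: emeasure_mono)
      then show "B \<in> null_sets \<nu>" using 0 by (auto simp: null_sets_def \<nu>_def)
    qed
    note ac = this
    have sets_\<nu>: "sets \<nu> = sets (distr M N Z)" by (simp add: \<nu>_def)
    have dens: "density (distr M N Z) (RN_deriv (distr M N Z) \<nu>) = \<nu>"
      by (rule Z.density_RN_deriv) fact+
    \<comment> \<open>\<open>RN_deriv\<close> takes values in \<open>ennreal\<close>; finiteness of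
      \<nu> permits the real version \<open>D\<close>.\<close>
    obtain D where D: "D \<in> borel_measurable (distr M N Z)"
        "AE z in distr M N Z. RN_deriv (distr M N Z) \<nu> z = ennreal (D z)"
        "AE z in \<nu>. 0 < D z" "\<And>z. 0 \<le> D z"
      by (rule Z.real_RN_deriv[OF fin ac sets_\<nu>]) (rule that, assumption+)
    have "density (distr M N Z) D = density (distr M N Z) (RN_deriv (distr M N Z) \<nu>)"
      using D by (intro density_cong) auto
    also note dens
    finally have D_dens: "density (distr M N Z) D = \<nu>" .
    have "emeasure \<nu> B = (\<integral>\<^sup>+z\<in>B. ennreal (D z) \<partial>distr M N Z)" if "B \<in> sets N" for B
      using that D(1) emeasure_density[of "\<lambda>z. ennreal (D z)" "distr M N Z" B] by (simp add: D_dens)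
    then show ?thesis using D \<nu> by (intro exI[of _ D]) auto
  qed
  then have "\<forall>y\<in>T. \<exists>f. f \<in> borel_measurable N \<and> (\<forall>z. 0 \<le> f z) \<and>
     (\<forall>B\<in>sets N. emeasure M {\<omega> \<in> space M. Z \<omega> \<in> B \<and> Y \<omega> = y}
          = (\<integral>\<^sup>+z\<in>B. ennreal (f z) \<partial>distr M N Z))" ..
  from bchoice[OF this] obtain q where "\<forall>y\<in>T. q y \<in> borel_measurable N \<and> (\<forall>z. 0 \<le> q y z) \<and>
     (\<forall>B\<in>sets N. emeasure M {\<omega> \<in> space M. Z \<omega> \<in> B \<and> Y \<omega> = y}
          = (\<integral>\<^sup>+z\<in>B. ennreal (q y z) \<partial>distr M N Z))" ..
  then show thesis by (intro that[of q]) (simp add: posterior_def)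
qed

text \<open>On the set \<open>B\<close> where \<open>q y\<close> exceeds 1, the integral of
  \<open>q y\<close> is \<open>P(Z in B, Y = y)\<close>, hence at most \<open>P(Z in B)\<close>, so
  the excess \<open>q y - 1\<close> integrates to 0 there. The bound holds only almost everywhere
  because the version is arbitrary.\<close>

lemma posterior_le_1:
  assumes "prob_space M" and Z[measurable]: "Z \<in> measurable M N"
    and q: "posterior M N Z T Y q" and y: "y \<in> T"
  shows "AE z in distr M N Z. q y z \<le> 1"
proof -
  interpret prob_space M by fact
  interpret Z: prob_space "distr M N Z" by (rule prob_space_distr) fact
  note qD = posteriorD[OF q y]
  note [measurable] = qD(1)
  define B where "B = {z \<in> space N. 1 < q y z}"
  have [measurable]: "B \<in> sets N" unfolding B_def by measurable
  \<comment> \<open>The excess is added to the measure of \<open>B\<close> rather than obtained by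
    subtraction, which keeps the computation within nonnegative integrals; the finite measure of
    \<open>B\<close> is cancelled at the end.\<close>
  have "(\<integral>\<^sup>+z. ennreal (q y z - 1) * indicator B z \<partial>distr M N Z) + emeasure (distr M N Z) B
      = (\<integral>\<^sup>+z. ennreal (q y z - 1) * indicator B z + indicator B z \<partial>distr M N Z)"
    by (subst nn_integral_add) auto
  also have "\<dots> = (\<integral>\<^sup>+z\<in>B. ennreal (q y z) \<partial>distr M N Z)"
  proof (intro nn_integral_cong)
    fix z
    have "ennreal (q y z - 1) + 1 = ennreal (q y z)" if "1 < q y z"
      using that ennreal_plus[of "q y z - 1" 1] by simp
    then show "ennreal (q y z - 1) * indicator B z + indicator B z = ennreal (q y z) * indicator B z"
      by (auto simp: B_def indicator_def)
  qed
  also have "\<dots> = emeasure M {\<omega> \<in> space M. Z \<omega> \<in> B \<and> Y \<omega> = y}"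
    by (rule qD(3)[symmetric]) fact
  also have "\<dots> \<le> emeasure M (Z -` B \<inter> space M)"
    by (intro emeasure_mono) auto
  also have "\<dots> = emeasure (distr M N Z) B"
    by (simp add: emeasure_distr)
  finally have "(\<integral>\<^sup>+z. ennreal (q y z - 1) * indicator B z \<partial>distr M N Z) = 0"
    using Z.emeasure_finite[of B] ennreal_add_left_cancel_le[of "emeasure (distr M N Z) B" "\<integral>\<^sup>+z. ennreal (q y z - 1) * indicator B z \<partial>distr M N Z" 0]
    by (simp add: add.commute top_unique)
  then have "AE z in distr M N Z. ennreal (q y z - 1) * indicator B z = 0"
    by (subst (asm) nn_integral_0_iff_AE) auto
  then show ?thesis
    using AE_space by eventually_elim (auto simp: B_def indicator_def not_less ennreal_eq_0_iff split: if_splits)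
qed

lemma measurable_posterior:
  assumes "posterior M N Z T Y q" "finite T"
  shows "(\<lambda>(z, y). q y z) \<in> borel_measurable (N \<Otimes>\<^sub>M count_space T)"
proof -
  have "(\<lambda>(y, z). q y z) \<in> borel_measurable (count_space T \<Otimes>\<^sub>M N)"
    using assms by (intro measurable_pair_measure_countable1) (auto intro: countable_finite posteriorD)
  from measurable_compose[OF measurable_pair_swap' this] show ?thesis
    by (simp add: case_prod_beta)
qed

text \<open>Taking the law of \<open>Z\<close> itself, times counting measure, as reference measure
  makes the posterior a joint density, so formulas stated for \<open>distributed\<close> variables
  apply to an arbitrary \<open>Z\<close>.\<close>

lemma posterior_distributed:
  assumes "prob_space M" and Z[measurable]: "Z \<in> measurable M N"
    and Y[measurable]: "Y \<in> measurable M (count_space T)" and T: "finite T"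
    and q: "posterior M N Z T Y q"
  shows "distributed M (distr M N Z \<Otimes>\<^sub>M count_space T) (\<lambda>\<omega>. (Z \<omega>, Y \<omega>)) (\<lambda>(z, y). ennreal (q y z))"
proof -
  interpret prob_space M by fact
  interpret Z: prob_space "distr M N Z" by (rule prob_space_distr) fact
  interpret T: sigma_finite_measure "count_space T"
    by (rule sigma_finite_measure_count_space_finite[OF T])
  interpret ZT: pair_sigma_finite "distr M N Z" "count_space T" ..
  note qD = posteriorD[OF q]
  have q_meas[measurable]: "(\<lambda>(z, y). q y z) \<in> borel_measurable (distr M N Z \<Otimes>\<^sub>M count_space T)"
    using measurable_posterior[OF q T] by simp
  show ?thesis
    unfolding distributed_def
  proof (intro conjI measure_eqI)
    show "(\<lambda>(z, y). ennreal (q y z)) \<in> borel_measurable (distr M N Z \<Otimes>\<^sub>M count_space T)"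
      by measurable
    show "(\<lambda>\<omega>. (Z \<omega>, Y \<omega>)) \<in> measurable M (distr M N Z \<Otimes>\<^sub>M count_space T)"
      by measurable
    fix A assume "A \<in> sets (distr M (distr M N Z \<Otimes>\<^sub>M count_space T) (\<lambda>\<omega>. (Z \<omega>, Y \<omega>)))"
    then have A[measurable]: "A \<in> sets (distr M N Z \<Otimes>\<^sub>M count_space T)" by simp
    have slice: "{z. (z, y) \<in> A} \<in> sets N" for y
      using sets_Pair2[OF A, of y] by (simp add: vimage_def)
    have "emeasure (distr M (distr M N Z \<Otimes>\<^sub>M count_space T) (\<lambda>\<omega>. (Z \<omega>, Y \<omega>))) A
        = emeasure M {\<omega> \<in> space M. (Z \<omega>, Y \<omega>) \<in> A}"
      by (subst emeasure_distr) (auto intro!: arg_cong[where f="emeasure M"])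
    \<comment> \<open>Splitting by class reduces a measurable set of pairs to its finitely many
      slices \<open>{z. (z, y) \<in> A}\<close>, to which the defining identity of \<open>q\<close>
      applies.\<close>
    also have "\<dots> = (\<Sum>y\<in>T. emeasure M {\<omega> \<in> space M. (Z \<omega>, Y \<omega>) \<in> A \<and> Y \<omega> = y})"
      by (intro emeasure_partition_finite Y T) measurable
    also have "\<dots> = (\<Sum>y\<in>T. emeasure M {\<omega> \<in> space M. Z \<omega> \<in> {z. (z, y) \<in> A} \<and> Y \<omega> = y})"
      by (intro sum.cong refl arg_cong[where f="emeasure M"]) auto
    also have "\<dots> = (\<Sum>y\<in>T. \<integral>\<^sup>+z. ennreal (q y z) * indicator A (z, y) \<partial>distr M N Z)"
      by (intro sum.cong refl, subst qD(3)[OF _ slice]) (auto intro!: nn_integral_cong simp: indicator_def)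
    also have "\<dots> = (\<integral>\<^sup>+y. \<integral>\<^sup>+z. (\<lambda>(z, y). ennreal (q y z) * indicator A (z, y)) (z, y) \<partial>distr M N Z \<partial>count_space T)"
      using T by (simp add: nn_integral_count_space_finite)
    also have "\<dots> = (\<integral>\<^sup>+x. (\<lambda>(z, y). ennreal (q y z) * indicator A (z, y)) x \<partial>(distr M N Z \<Otimes>\<^sub>M count_space T))"
      by (rule ZT.nn_integral_snd) measurable
    also have "\<dots> = emeasure (density (distr M N Z \<Otimes>\<^sub>M count_space T) (\<lambda>(z, y). ennreal (q y z))) A"
      by (subst emeasure_density) (auto intro!: nn_integral_cong)
    finally show "emeasure (distr M (distr M N Z \<Otimes>\<^sub>M count_space T) (\<lambda>\<omega>. (Z \<omega>, Y \<omega>))) A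
      = emeasure (density (distr M N Z \<Otimes>\<^sub>M count_space T) (\<lambda>(z, y). ennreal (q y z))) A" .
  qed simp
qed

lemma measurable_posterior_comp:
  assumes "posterior M N Z T Y q" "finite T"
    and "Z \<in> measurable M N" "Y \<in> measurable M (count_space T)"
  shows "(\<lambda>\<omega>. q (Y \<omega>) (Z \<omega>)) \<in> borel_measurable M"
  using measurable_compose[OF measurable_Pair[OF assms(3,4)] measurable_posterior[OF assms(1,2)]] by simp

text \<open>A density is positive almost everywhere for the measure it defines, here the joint law
  of \<open>Z\<close> and \<open>Y\<close>. Only the class that occurs is covered;
  \<open>q y z\<close> may vanish for other classes.\<close>

lemma posterior_pos:
  assumes "prob_space M" and Z[measurable]: "Z \<in> measurable M N"
    and Y[measurable]: "Y \<in> measurable M (count_space T)" and T: "finite T"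
    and q: "posterior M N Z T Y q"
  shows "AE \<omega> in M. 0 < q (Y \<omega>) (Z \<omega>)"
proof -
  note dist = posterior_distributed[OF assms]
  have "AE x in density (distr M N Z \<Otimes>\<^sub>M count_space T) (\<lambda>(z, y). ennreal (q y z)). 0 < (case x of (z, y) \<Rightarrow> q y z)"
    by (subst AE_density[OF distributed_borel_measurable[OF dist]]) auto
  from AE_distrD[OF distributed_measurable[OF dist] this[folded distributed_distr_eq_density[OF dist]]]
  show ?thesis by simp
qed

text \<open>The inequality \<open>ln u \<le> u - 1\<close> at \<open>u = 1 / x\<close> gives
  \<open>- x * ln x \<le> 1 - x\<close>.\<close>

lemma abs_mult_ln_le_1:
  fixes x :: real
  assumes "0 \<le> x" "x \<le> 1"
  shows "\<bar>x * ln x\<bar> \<le> 1"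
proof (cases "x = 0")
  case False
  then have "ln (1 / x) \<le> 1 / x - 1" using assms by (intro ln_le_minus_one) auto
  then have "x * - ln x \<le> x * (1 / x - 1)"
    using assms False by (intro mult_left_mono) (auto simp: ln_div)
  moreover have "ln x \<le> 0" using assms False by simp
  then have "x * ln x \<le> 0" using assms by (simp add: mult_nonneg_nonpos)
  ultimately show ?thesis using assms False by (simp add: algebra_simps)
qed simp

text \<open>Averaging over the joint law multiplies \<open>log b q\<close> by the density
  \<open>q\<close>, and the product is bounded for \<open>q\<close> between 0 and 1. Since
  \<open>T\<close> is finite, the reference measure is finite, and a bounded integrand
  suffices.\<close>

lemma posterior_integrable_log:
  assumes "prob_space M" and Z[measurable]: "Z \<in> measurable M N"
    and Y[measurable]: "Y \<in> measurable M (count_space T)" and T: "finite T"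
    and q: "posterior M N Z T Y q" and b: "1 < b"
  shows "integrable M (\<lambda>\<omega>. log b (q (Y \<omega>) (Z \<omega>)))"
proof -
  interpret prob_space M by fact
  interpret Z: prob_space "distr M N Z" by (rule prob_space_distr) fact
  interpret T: finite_measure "count_space T" by (rule finite_measure_count_space[OF T])
  interpret ZT: pair_sigma_finite "distr M N Z" "count_space T" ..
  interpret ZT: finite_measure "distr M N Z \<Otimes>\<^sub>M count_space T"
    by (intro finite_measure_pair_measure) unfold_locales
  note dist = posterior_distributed[OF assms(1-5)]
  have [measurable]: "(\<lambda>(z, y). q y z) \<in> borel_measurable (distr M N Z \<Otimes>\<^sub>M count_space T)"
    using measurable_posterior[OF q T] by simp
  have "integrable (distr M N Z \<Otimes>\<^sub>M count_space T) (\<lambda>x. (case x of (z, y) \<Rightarrow> q y z) * log b (case x of (z, y) \<Rightarrow> q y z))"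
  \<comment> \<open>The constant is the bound 1 from \<open>abs_mult_ln_le_1\<close> divided by the
    \<open>ln b\<close> inside \<open>log b\<close>.\<close>
  proof (rule ZT.integrable_const_bound[where B="1 / ln b"])
    have "AE x in distr M N Z \<Otimes>\<^sub>M count_space T. (case x of (z, y) \<Rightarrow> q y z) \<le> 1"
    proof (rule ZT.AE_pair_measure)
      have "AE z in distr M N Z. \<forall>y\<in>T. q y z \<le> 1"
        using posterior_le_1[OF assms(1) Z q] T by (intro AE_ball_countable') (auto intro: countable_finite)
      then show "AE z in distr M N Z. AE y in count_space T. (case (z, y) of (z, y) \<Rightarrow> q y z) \<le> 1"
        by eventually_elim (auto simp: AE_count_space)
    qed measurable
    then show "AE x in distr M N Z \<Otimes>\<^sub>M count_space T.
        norm ((case x of (z, y) \<Rightarrow> q y z) * log b (case x of (z, y) \<Rightarrow> q y z)) \<le> 1 / ln b"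
      using AE_space
    proof eventually_elim
      case (elim x)
      obtain z y where x: "x = (z, y)" by force
      have "y \<in> T" using elim x by (auto simp: space_pair_measure)
      then have "\<bar>q y z * ln (q y z)\<bar> \<le> 1"
        using elim x posteriorD(2)[OF q] by (intro abs_mult_ln_le_1) auto
      then show ?case using b
        by (simp add: x log_def abs_mult divide_right_mono)
    qed
  qed measurable
  moreover have "distributed M (distr M N Z \<Otimes>\<^sub>M count_space T) (\<lambda>\<omega>. (Z \<omega>, Y \<omega>)) (\<lambda>x. ennreal (case x of (z, y) \<Rightarrow> q y z))"
    using dist by (simp add: case_prod_beta')
  ultimately have "integrable M (\<lambda>\<omega>. log b (case (Z \<omega>, Y \<omega>) of (z, y) \<Rightarrow> q y z))"
    by (subst (asm) distributed_integrable) (use posteriorD(2)[OF q] in \<open>auto simp: space_pair_measure\<close>)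
  then show ?thesis by simp
qed

text \<open>Observing a constant turns the posterior into the prior, so positivity and
  log-integrability of the class probabilities become instances of the results on
  posteriors.\<close>

lemma posterior_trivial:
  assumes "prob_space M" and Y: "Y \<in> measurable M (count_space T)"
  shows "posterior M (count_space UNIV) (\<lambda>_. ()) T Y (\<lambda>y _. measure M {\<omega> \<in> space M. Y \<omega> = y})"
proof -
  interpret prob_space M by fact
  have "emeasure M {\<omega> \<in> space M. () \<in> B \<and> Y \<omega> = y}
      = (\<integral>\<^sup>+z\<in>B. ennreal (measure M {\<omega> \<in> space M. Y \<omega> = y}) \<partial>distr M (count_space UNIV) (\<lambda>_. ()))" for B y
    by (cases "() \<in> B") (simp_all add: nn_integral_distr indicator_def emeasure_eq_measure emeasure_space_1)
  then show ?thesis unfolding posterior_def by simp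
qed

lemma distributed_class_prob:
  assumes "prob_space M" and Y: "Y \<in> measurable M (count_space T)" and T: "finite T"
  shows "distributed M (count_space T) Y (\<lambda>y. ennreal (measure M {\<omega> \<in> space M. Y \<omega> = y}))"
proof -
  interpret prob_space M by fact
  show ?thesis
    unfolding distributed_def
  proof (intro conjI Y measure_eqI_finite[OF _ _ T])
    fix y assume y: "y \<in> T"
    have "emeasure (distr M (count_space T) Y) {y} = emeasure M {\<omega> \<in> space M. Y \<omega> = y}"
      using y by (subst emeasure_distr[OF Y]) (auto intro!: arg_cong[where f="emeasure M"])
    also have "\<dots> = emeasure (density (count_space T) (\<lambda>y. ennreal (measure M {\<omega> \<in> space M. Y \<omega> = y}))) {y}"
      using y T by (simp add: emeasure_density nn_integral_count_space_finite emeasure_eq_measure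
          sum.remove[of T y] indicator_def)
    finally show "emeasure (distr M (count_space T) Y) {y}
      = emeasure (density (count_space T) (\<lambda>y. ennreal (measure M {\<omega> \<in> space M. Y \<omega> = y}))) {y}" .
  qed auto
qed

text \<open>Relative to the law of \<open>Z\<close> and counting measure, the densities of
  \<open>Z\<close>, \<open>Y\<close> and the pair are 1, \<open>p\<close> and \<open>q\<close>, so
  the divergence is the expectation of \<open>log b (q / p)\<close>. Nonnegativity is recorded
  because \<open>cond_mutual_info\<close> passes the inner value through \<open>ennreal\<close>,
  which would send a negative value to 0.\<close>

lemma
  assumes "prob_space M" and Z[measurable]: "Z \<in> measurable M N"
    and Y[measurable]: "Y \<in> measurable M (count_space T)" and T: "finite T"
    and q: "posterior M N Z T Y q" and b: "1 < b"
  defines "p \<equiv> \<lambda>y. measure M {\<omega> \<in> space M. Y \<omega> = y}"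
  shows mutual_information_posterior:
      "prob_space.mutual_information M b N (count_space T) Z Y
        = (\<integral>\<omega>. log b (q (Y \<omega>) (Z \<omega>)) - log b (p (Y \<omega>)) \<partial>M)" (is ?eq)
    and mutual_information_finite_nonneg:
      "0 \<le> prob_space.mutual_information M b N (count_space T) Z Y" (is ?nonneg)
    and integrable_log_class_prob: "integrable M (\<lambda>\<omega>. log b (p (Y \<omega>)))" (is ?int)
proof -
  interpret prob_space M by fact
  interpret information_space M b by unfold_locales fact
  interpret Z: prob_space "distr M N Z" by (rule prob_space_distr) fact
  have "prob_space (distr M N Z)" "sigma_finite_measure (distr M N Z)" by unfold_locales
  have triv: "posterior M (count_space UNIV) (\<lambda>_. ()) T Y (\<lambda>y _. p y)"
    unfolding p_def by (rule posterior_trivial) fact+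
  show ?int
    using posterior_integrable_log[OF \<open>prob_space M\<close> _ Y T triv b] by simp
  have p_pos: "AE \<omega> in M. 0 < p (Y \<omega>)"
    using posterior_pos[OF \<open>prob_space M\<close> _ Y T triv] by simp
  note q_pos = posterior_pos[OF \<open>prob_space M\<close> Z Y T q]
  note q_int = posterior_integrable_log[OF \<open>prob_space M\<close> Z Y T q b]
  have log_eq: "AE \<omega> in M. log b (q (Y \<omega>) (Z \<omega>) / p (Y \<omega>)) = log b (q (Y \<omega>) (Z \<omega>)) - log b (p (Y \<omega>))"
    using p_pos q_pos by eventually_elim (use b in \<open>simp add: log_divide\<close>)
  define f where "f = (\<lambda>x. (case x of (z, y) \<Rightarrow> q y z) * log b ((case x of (z, y) \<Rightarrow> q y z) / (1 * p (snd x))))"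
  have dZ: "distributed M (distr M N Z) Z (\<lambda>x. ennreal 1)"
    unfolding distributed_def by (auto simp: density_1 intro!: distr_cong)
  have dY: "distributed M (count_space T) Y (\<lambda>y. ennreal (p y))"
    unfolding p_def by (rule distributed_class_prob) fact+
  have dZY: "distributed M (distr M N Z \<Otimes>\<^sub>M count_space T) (\<lambda>\<omega>. (Z \<omega>, Y \<omega>)) (\<lambda>x. ennreal (case x of (z, y) \<Rightarrow> q y z))"
    using posterior_distributed[OF \<open>prob_space M\<close> Z Y T q] by (simp add: case_prod_beta')
  have q_nonneg: "0 \<le> (case x of (z, y) \<Rightarrow> q y z)" if "x \<in> space (distr M N Z \<Otimes>\<^sub>M count_space T)" for x
    using that posteriorD(2)[OF q] by (auto simp: space_pair_measure)
  have [measurable]: "(\<lambda>(z, y). q y z) \<in> borel_measurable (distr M N Z \<Otimes>\<^sub>M count_space T)"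
    using measurable_posterior[OF q T] by simp
  have [measurable]: "p \<in> borel_measurable (count_space T)" by simp
  have g: "(\<lambda>x. log b ((case x of (z, y) \<Rightarrow> q y z) / (1 * p (snd x)))) \<in> borel_measurable (distr M N Z \<Otimes>\<^sub>M count_space T)"
    by measurable
  have MI: "mutual_information b (distr M N Z) (count_space T) Z Y = integral\<^sup>L (distr M N Z \<Otimes>\<^sub>M count_space T) f"
    and MI': "integrable (distr M N Z \<Otimes>\<^sub>M count_space T) f \<Longrightarrow> 0 \<le> mutual_information b (distr M N Z) (count_space T) Z Y"
    using mutual_information_distr[OF \<open>sigma_finite_measure (distr M N Z)\<close>
        sigma_finite_measure_count_space_finite[OF T] dZ _ dY _ dZY]
      mutual_information_nonneg[OF \<open>sigma_finite_measure (distr M N Z)\<close>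
        sigma_finite_measure_count_space_finite[OF T] dZ _ dY _ dZY] q_nonneg
    by (auto simp: f_def p_def space_pair_measure)
  \<comment> \<open>The law of \<open>Z\<close> has the same measurable sets as \<open>N\<close>,
    and mutual information sees its base spaces only through \<open>distr\<close>; hence
    \<open>distr M N Z\<close> may be exchanged for \<open>N\<close>.\<close>
  have sets_eq: "sets (distr M N Z \<Otimes>\<^sub>M count_space T) = sets (N \<Otimes>\<^sub>M count_space T)"
    by (intro sets_pair_measure_cong) auto
  have base: "mutual_information b (distr M N Z) (count_space T) Z Y = mutual_information b N (count_space T) Z Y"
    unfolding mutual_information_def
    by (simp add: distr_cong[OF refl sets_eq refl] distr_cong[OF refl sets_distr refl])
  have "integrable M (\<lambda>\<omega>. log b (q (Y \<omega>) (Z \<omega>) / p (Y \<omega>)))"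
    using Bochner_Integration.integrable_diff[OF q_int \<open>?int\<close>] log_eq
    by (subst integrable_cong_AE) (auto simp: measurable_posterior_comp[OF q T Z Y] intro: borel_measurable_integrable[OF \<open>?int\<close>])
  then have "integrable (distr M N Z \<Otimes>\<^sub>M count_space T) f"
    unfolding f_def by (subst distributed_integrable[OF dZY g q_nonneg]) auto
  from MI'[OF this] base show ?nonneg by simp
  have "integral\<^sup>L (distr M N Z \<Otimes>\<^sub>M count_space T) f = (\<integral>\<omega>. log b (q (Y \<omega>) (Z \<omega>) / p (Y \<omega>)) \<partial>M)"
    unfolding f_def by (subst distributed_integral[OF dZY g q_nonneg]) auto
  also have "\<dots> = (\<integral>\<omega>. log b (q (Y \<omega>) (Z \<omega>)) - log b (p (Y \<omega>)) \<partial>M)"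
    using log_eq measurable_posterior_comp[OF q T Z Y] borel_measurable_integrable[OF \<open>?int\<close>] \<open>integrable M (\<lambda>\<omega>. log b (q (Y \<omega>) (Z \<omega>) / p (Y \<omega>)))\<close>
    by (intro integral_cong_AE) auto
  finally show ?eq using MI base by simp
qed

section \<open>Disintegration of joint laws along a conditional law\<close>

lemma cond_lawD:
  assumes "cond_law M N Z U C K"
  shows "K \<in> measurable U (prob_algebra N)" "K \<in> measurable U (subprob_algebra N)"
    and "A \<in> sets U \<Longrightarrow> B \<in> sets N \<Longrightarrow> emeasure M {\<omega> \<in> space M. C \<omega> \<in> A \<and> Z \<omega> \<in> B}
          = (\<integral>\<^sup>+c\<in>A. emeasure (K c) B \<partial>distr M U C)"
    and "c \<in> space U \<Longrightarrow> prob_space (K c)" "c \<in> space U \<Longrightarrow> sets (K c) = sets N"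
  using assms measurable_space[of K U "prob_algebra N"]
  by (auto simp: cond_law_def space_prob_algebra measurable_prob_algebraD)

text \<open>\<open>cond_law\<close> tests only rectangles. These form an intersection-stable
  generator of the product sigma-algebra, so agreement on them fixes the whole joint law, which is
  finite.\<close>

lemma cond_law_distr_eq_bind:
  assumes "prob_space M" and C[measurable]: "C \<in> measurable M U" and Z[measurable]: "Z \<in> measurable M N"
    and K: "cond_law M N Z U C K"
  shows "distr M (U \<Otimes>\<^sub>M N) (\<lambda>\<omega>. (C \<omega>, Z \<omega>)) = distr M U C \<bind> (\<lambda>c. distr (K c) (U \<Otimes>\<^sub>M N) (Pair c))"
proof -
  interpret prob_space M by fact
  interpret C: prob_space "distr M U C" by (rule prob_space_distr) fact
  interpret CZ: prob_space "distr M (U \<Otimes>\<^sub>M N) (\<lambda>\<omega>. (C \<omega>, Z \<omega>))" by (rule prob_space_distr) measurable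
  note KD = cond_lawD[OF K]
  note [measurable] = KD(2)
  let ?k = "\<lambda>c. distr (K c) (U \<Otimes>\<^sub>M N) (Pair c)"
  have k[measurable]: "?k \<in> measurable (distr M U C) (subprob_algebra (U \<Otimes>\<^sub>M N))"
    by (rule measurable_distr2[where M=N]) (use KD(2) in auto)
  have ne: "space (distr M U C) \<noteq> {}" by (rule C.not_empty)
  have sets_bind: "sets (distr M U C \<bind> ?k) = sets (U \<Otimes>\<^sub>M N)"
    by (rule sets_bind) (use ne in auto)
  show ?thesis
  proof (rule measure_eqI_generator_eq[OF Int_stable_pair_measure_generator[of U N]])
    show "{a \<times> b |a b. a \<in> sets U \<and> b \<in> sets N} \<subseteq> Pow (space U \<times> space N)"
      by (auto dest: sets.sets_into_space)
    show "sets (distr M (U \<Otimes>\<^sub>M N) (\<lambda>\<omega>. (C \<omega>, Z \<omega>))) = sigma_sets (space U \<times> space N) {a \<times> b |a b. a \<in> sets U \<and> b \<in> sets N}"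
      by (simp add: sets_pair_measure)
    show "sets (distr M U C \<bind> ?k) = sigma_sets (space U \<times> space N) {a \<times> b |a b. a \<in> sets U \<and> b \<in> sets N}"
      unfolding sets_bind by (simp add: sets_pair_measure)
    show "range (\<lambda>n::nat. space U \<times> space N) \<subseteq> {a \<times> b |a b. a \<in> sets U \<and> b \<in> sets N}"
      "(\<Union>n::nat. space U \<times> space N) = space U \<times> space N"
      by auto
    show "emeasure (distr M (U \<Otimes>\<^sub>M N) (\<lambda>\<omega>. (C \<omega>, Z \<omega>))) (space U \<times> space N) \<noteq> \<infinity>" for n :: nat
      by simp
    fix E assume "E \<in> {a \<times> b |a b. a \<in> sets U \<and> b \<in> sets N}"
    then obtain A B where E: "E = A \<times> B" and [measurable]: "A \<in> sets U" "B \<in> sets N" by auto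
    have "emeasure (distr M (U \<Otimes>\<^sub>M N) (\<lambda>\<omega>. (C \<omega>, Z \<omega>))) E = emeasure M {\<omega> \<in> space M. C \<omega> \<in> A \<and> Z \<omega> \<in> B}"
      by (subst emeasure_distr) (auto simp: E intro!: arg_cong[where f="emeasure M"])
    also have "\<dots> = (\<integral>\<^sup>+c\<in>A. emeasure (K c) B \<partial>distr M U C)"
      by (rule KD(3)) fact+
    also have "\<dots> = (\<integral>\<^sup>+c. emeasure (?k c) E \<partial>distr M U C)"
    proof (intro nn_integral_cong)
      fix c assume "c \<in> space (distr M U C)"
      then have c: "c \<in> space U" by simp
      have [measurable_cong]: "sets (K c) = sets N" by (rule KD(5)) fact
      have "emeasure (?k c) E = emeasure (K c) (Pair c -` E \<inter> space (K c))"
        using c by (subst emeasure_distr) (auto simp: E)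
      also have "Pair c -` E \<inter> space (K c) = (if c \<in> A then B else {})"
        using sets.sets_into_space[OF \<open>B \<in> sets N\<close>] sets_eq_imp_space_eq[OF KD(5)[OF c]] by (auto simp: E)
      finally show "emeasure (K c) B * indicator A c = emeasure (?k c) E" by simp
    qed
    also have "\<dots> = emeasure (distr M U C \<bind> ?k) E"
      by (rule emeasure_bind[OF ne k, symmetric]) (auto simp: E)
    finally show "emeasure (distr M (U \<Otimes>\<^sub>M N) (\<lambda>\<omega>. (C \<omega>, Z \<omega>))) E = emeasure (distr M U C \<bind> ?k) E" .
  qed
qed

text \<open>Fubini's theorem for a kernel, read off from the joint law written as a
  \<open>bind\<close>.\<close>

lemma cond_law_nn_integral:
  assumes "prob_space M" and C[measurable]: "C \<in> measurable M U" and Z[measurable]: "Z \<in> measurable M N"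
    and K: "cond_law M N Z U C K" and f[measurable]: "f \<in> borel_measurable (U \<Otimes>\<^sub>M N)"
  shows "(\<integral>\<^sup>+\<omega>. f (C \<omega>, Z \<omega>) \<partial>M) = (\<integral>\<^sup>+c. \<integral>\<^sup>+z. f (c, z) \<partial>K c \<partial>distr M U C)"
proof -
  note KD = cond_lawD[OF K]
  let ?k = "\<lambda>c. distr (K c) (U \<Otimes>\<^sub>M N) (Pair c)"
  have k: "?k \<in> measurable (distr M U C) (subprob_algebra (U \<Otimes>\<^sub>M N))"
    by (rule measurable_distr2[where M=N]) (use KD(2) in auto)
  have "(\<integral>\<^sup>+\<omega>. f (C \<omega>, Z \<omega>) \<partial>M) = (\<integral>\<^sup>+x. f x \<partial>distr M (U \<Otimes>\<^sub>M N) (\<lambda>\<omega>. (C \<omega>, Z \<omega>)))"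
    by (subst nn_integral_distr) auto
  also have "\<dots> = (\<integral>\<^sup>+c. \<integral>\<^sup>+x. f x \<partial>?k c \<partial>distr M U C)"
    unfolding cond_law_distr_eq_bind[OF assms(1-4)] by (rule nn_integral_bind[OF f k])
  also have "\<dots> = (\<integral>\<^sup>+c. \<integral>\<^sup>+z. f (c, z) \<partial>K c \<partial>distr M U C)"
  proof (intro nn_integral_cong)
    fix c assume "c \<in> space (distr M U C)"
    then have c: "c \<in> space U" by simp
    have [measurable_cong]: "sets (K c) = sets N" by (rule KD(5)) fact
    show "(\<integral>\<^sup>+x. f x \<partial>?k c) = (\<integral>\<^sup>+z. f (c, z) \<partial>K c)"
      using c by (subst nn_integral_distr) auto
  qed
  finally show ?thesis .
qed

text \<open>
  Splitting into positive and negative part reduces the claim to nonnegative integrands.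
\<close>

lemma cond_law_integral:
  fixes f :: "'c \<times> 'b \<Rightarrow> real"
  assumes "prob_space M" and C[measurable]: "C \<in> measurable M U" and Z[measurable]: "Z \<in> measurable M N"
    and K: "cond_law M N Z U C K" and f[measurable]: "f \<in> borel_measurable (U \<Otimes>\<^sub>M N)"
    and int: "integrable M (\<lambda>\<omega>. f (C \<omega>, Z \<omega>))"
    and inner: "AE c in distr M U C. integrable (K c) (\<lambda>z. f (c, z)) \<and> 0 \<le> (\<integral>z. f (c, z) \<partial>K c)"
  shows "enn2real (\<integral>\<^sup>+c. ennreal (\<integral>z. f (c, z) \<partial>K c) \<partial>distr M U C) = (\<integral>\<omega>. f (C \<omega>, Z \<omega>) \<partial>M)"
proof -
  note KD = cond_lawD[OF K]
  note [measurable] = KD(2)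
  define P where "P c = (\<integral>\<^sup>+z. ennreal (f (c, z)) \<partial>K c)" for c
  define Q where "Q c = (\<integral>\<^sup>+z. ennreal (- f (c, z)) \<partial>K c)" for c
  have [measurable]: "P \<in> borel_measurable (distr M U C)" "Q \<in> borel_measurable (distr M U C)"
    unfolding P_def Q_def
    by (auto intro!: nn_integral_measurable_subprob_algebra2[where N=N])
  have P: "(\<integral>\<^sup>+\<omega>. ennreal (f (C \<omega>, Z \<omega>)) \<partial>M) = (\<integral>\<^sup>+c. P c \<partial>distr M U C)"
    unfolding P_def by (rule cond_law_nn_integral[OF assms(1-4), of "\<lambda>x. ennreal (f x)"]) simp
  have Q: "(\<integral>\<^sup>+\<omega>. ennreal (- f (C \<omega>, Z \<omega>)) \<partial>M) = (\<integral>\<^sup>+c. Q c \<partial>distr M U C)"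
    unfolding Q_def by (rule cond_law_nn_integral[OF assms(1-4), of "\<lambda>x. ennreal (- f x)"]) simp
  have fin: "(\<integral>\<^sup>+\<omega>. ennreal (f (C \<omega>, Z \<omega>)) \<partial>M) \<noteq> \<infinity>" "(\<integral>\<^sup>+\<omega>. ennreal (- f (C \<omega>, Z \<omega>)) \<partial>M) \<noteq> \<infinity>"
    using int by (auto simp: real_integrable_def)
  \<comment> \<open>Nonnegativity of the inner integral gives \<open>Q c \<le> P c\<close>, so
    neither the subtraction in \<open>ennreal\<close> nor the coercion of the real integral
    truncates anything.\<close>
  have ae: "AE c in distr M U C. Q c \<le> P c \<and> ennreal (\<integral>z. f (c, z) \<partial>K c) = P c - Q c"
    using inner
  proof eventually_elim
    case (elim c)
    then have "P c \<noteq> \<infinity>" "Q c \<noteq> \<infinity>" and eq: "(\<integral>z. f (c, z) \<partial>K c) = enn2real (P c) - enn2real (Q c)"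
      by (auto simp: P_def Q_def real_integrable_def real_lebesgue_integral_def)
    then obtain p q where "P c = ennreal p" "0 \<le> p" "Q c = ennreal q" "0 \<le> q"
      by (cases "P c"; cases "Q c") auto
    then show ?case using elim eq by (auto simp: ennreal_minus)
  qed
  have "(\<integral>\<^sup>+c. ennreal (\<integral>z. f (c, z) \<partial>K c) \<partial>distr M U C) = (\<integral>\<^sup>+c. P c - Q c \<partial>distr M U C)"
    using ae by (intro nn_integral_cong_AE) auto
  also have "\<dots> = (\<integral>\<^sup>+c. P c \<partial>distr M U C) - (\<integral>\<^sup>+c. Q c \<partial>distr M U C)"
    using ae fin Q by (intro nn_integral_diff) auto
  finally have "enn2real (\<integral>\<^sup>+c. ennreal (\<integral>z. f (c, z) \<partial>K c) \<partial>distr M U C)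
      = enn2real ((\<integral>\<^sup>+c. P c \<partial>distr M U C) - (\<integral>\<^sup>+c. Q c \<partial>distr M U C))" by simp
  moreover have "(\<integral>\<^sup>+c. Q c \<partial>distr M U C) \<le> (\<integral>\<^sup>+c. P c \<partial>distr M U C)"
    using ae by (intro nn_integral_mono_AE) auto
  ultimately show ?thesis
    using fin unfolding real_lebesgue_integral_def[OF int] P Q
    by (cases "\<integral>\<^sup>+c. P c \<partial>distr M U C"; cases "\<integral>\<^sup>+c. Q c \<partial>distr M U C") (auto simp: ennreal_minus)
qed

section \<open>Conditional laws and posteriors\<close>

text \<open>Distribution functions determine finite Borel measures on the line and are right
  continuous: a nonzero difference at \<open>a\<close> would persist on an interval to the right of
  \<open>a\<close>, which contains a rational.\<close>

lemma measure_eqI_atMost_rat: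
  assumes "finite_measure \<mu>" "finite_measure \<nu>"
    and sets: "sets \<mu> = sets (borel :: real measure)" "sets \<nu> = sets (borel :: real measure)"
    and eq: "\<And>r. r \<in> \<rat> \<Longrightarrow> emeasure \<mu> {..r} = emeasure \<nu> {..r}"
  shows "\<mu> = \<nu>"
proof (rule cdf_unique')
  interpret \<mu>: finite_measure \<mu> by fact
  interpret \<nu>: finite_measure \<nu> by fact
  show \<mu>: "finite_borel_measure \<mu>" and \<nu>: "finite_borel_measure \<nu>"
    by (auto simp: finite_borel_measure_def finite_borel_measure_axioms_def sets assms)
  show "cdf \<mu> = cdf \<nu>"
  proof
    fix a
    have "((\<lambda>x. cdf \<mu> x - cdf \<nu> x) \<longlongrightarrow> cdf \<mu> a - cdf \<nu> a) (at_right a)"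
      using finite_borel_measure.cdf_is_right_cont[OF \<mu>, of a] finite_borel_measure.cdf_is_right_cont[OF \<nu>, of a]
      by (auto simp: continuous_within intro: tendsto_diff)
    show "cdf \<mu> a = cdf \<nu> a"
    proof (rule ccontr)
      assume "cdf \<mu> a \<noteq> cdf \<nu> a"
      then have "cdf \<mu> a - cdf \<nu> a \<noteq> 0" by simp
      then have "eventually (\<lambda>x. cdf \<mu> x - cdf \<nu> x \<noteq> 0) (at_right a)"
        by (rule tendsto_imp_eventually_ne[rotated]) fact
      then obtain b where b: "a < b" "\<And>x. a < x \<Longrightarrow> x < b \<Longrightarrow> cdf \<mu> x - cdf \<nu> x \<noteq> 0"
        unfolding eventually_at_right_field by blast
      obtain r where "r \<in> \<rat>" "a < r" "r < b" using Rats_dense_in_real[OF b(1)] by blast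
      then show False using b(2)[of r] eq[of r] by (simp add: cdf_def measure_def)
    qed
  qed
qed

lemma posterior_density:
  assumes Z[measurable]: "Z \<in> measurable M N"
    and Y: "Y \<in> measurable M (count_space T)" and q: "posterior M N Z T Y q" and y: "y \<in> T"
  shows "distr (density M (indicator {\<omega> \<in> space M. Y \<omega> = y})) N Z = density (distr M N Z) (\<lambda>z. ennreal (q y z))"
proof (rule measure_eqI)
  note [measurable] = posteriorD(1)[OF q y] sets_eq_count_space[OF Y]
  fix B assume "B \<in> sets (distr (density M (indicator {\<omega> \<in> space M. Y \<omega> = y})) N Z)"
  then have B[measurable]: "B \<in> sets N" by simp
  have "emeasure (distr (density M (indicator {\<omega> \<in> space M. Y \<omega> = y})) N Z) B
      = emeasure M {\<omega> \<in> space M. Z \<omega> \<in> B \<and> Y \<omega> = y}"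
    by (subst emeasure_distr_restricted) (auto intro!: arg_cong[where f="emeasure M"])
  then show "emeasure (distr (density M (indicator {\<omega> \<in> space M. Y \<omega> = y})) N Z) B
      = emeasure (density (distr M N Z) (\<lambda>z. ennreal (q y z))) B"
    by (simp add: emeasure_density posteriorD(3)[OF q y B])
qed simp

text \<open>Extends the defining identity of a posterior from indicators to nonnegative integrands,
  by reading \<open>q y\<close> as a density of the law of \<open>Z\<close> restricted to
  \<open>Y = y\<close>.\<close>

lemma posterior_nn_integral:
  assumes Z[measurable]: "Z \<in> measurable M N"
    and Y: "Y \<in> measurable M (count_space T)" and q: "posterior M N Z T Y q" and y: "y \<in> T"
    and f[measurable]: "f \<in> borel_measurable N"
  shows "(\<integral>\<^sup>+\<omega>. f (Z \<omega>) * indicator {y} (Y \<omega>) \<partial>M) = (\<integral>\<^sup>+z. ennreal (q y z) * f z \<partial>distr M N Z)"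
proof -
  note [measurable] = posteriorD(1)[OF q y] sets_eq_count_space[OF Y]
  have "(\<integral>\<^sup>+z. ennreal (q y z) * f z \<partial>distr M N Z)
      = (\<integral>\<^sup>+z. f z \<partial>distr (density M (indicator {\<omega> \<in> space M. Y \<omega> = y})) N Z)"
    unfolding posterior_density[OF assms(1-4)] by (subst nn_integral_density) auto
  also have "\<dots> = (\<integral>\<^sup>+\<omega>. f (Z \<omega>) \<partial>density M (indicator {\<omega> \<in> space M. Y \<omega> = y}))"
    by (subst nn_integral_distr) auto
  also have "\<dots> = (\<integral>\<^sup>+\<omega>. f (Z \<omega>) * indicator {y} (Y \<omega>) \<partial>M)"
    by (subst nn_integral_density) (auto intro!: nn_integral_cong simp: indicator_def)
  finally show ?thesis ..
qed

text \<open>Uniqueness of densities. Identities between conditional quantities are obtained from it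
  by integrating both sides over an arbitrary \<open>D\<close> and recognising the same
  probability.\<close>

lemma AE_eq_of_set_nn_integral_eq:
  assumes "prob_space M" and C: "C \<in> measurable M U"
    and [measurable]: "f \<in> borel_measurable U" "g \<in> borel_measurable U"
    and eq: "\<And>D. D \<in> sets U \<Longrightarrow> (\<integral>\<^sup>+c\<in>D. f c \<partial>distr M U C) = (\<integral>\<^sup>+c\<in>D. g c \<partial>distr M U C)"
  shows "AE c in distr M U C. f c = (g c :: ennreal)"
proof -
  interpret prob_space M by fact
  interpret C: prob_space "distr M U C" by (rule prob_space_distr) fact
  show ?thesis
    by (rule C.density_unique_finite_measure) (auto intro: eq)
qed

text \<open>Computes the joint probability with the class drawn before \<open>A\<close>.
  \<open>cond_law_pair_class\<close> computes it in the other order, and comparing the two is Bayes'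
  rule.\<close>

lemma cond_law_class:
  assumes "prob_space M" and C[measurable]: "C \<in> measurable M U"
    and A[measurable]: "A \<in> measurable M N" and Y[measurable]: "Y \<in> measurable M (count_space T)"
    and L: "cond_law M N A (U \<Otimes>\<^sub>M count_space T) (\<lambda>\<omega>. (C \<omega>, Y \<omega>)) L"
    and r: "posterior M U C T Y r" and y: "y \<in> T"
    and D[measurable]: "D \<in> sets U" and B: "B \<in> sets N"
  shows "emeasure M {\<omega> \<in> space M. C \<omega> \<in> D \<and> A \<omega> \<in> B \<and> Y \<omega> = y}
      = (\<integral>\<^sup>+c\<in>D. ennreal (r y c) * emeasure (L (c, y)) B \<partial>distr M U C)"
proof -
  have L_meas: "(\<lambda>x. emeasure (L x) B) \<in> borel_measurable (U \<Otimes>\<^sub>M count_space T)"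
    using measurable_compose[OF cond_lawD(2)[OF L] measurable_emeasure_subprob_algebra[OF B]] .
  have [measurable]: "(\<lambda>c. emeasure (L (c, y)) B) \<in> borel_measurable U"
    using y by (intro measurable_compose[OF measurable_Pair2' L_meas]) simp
  have "emeasure M {\<omega> \<in> space M. C \<omega> \<in> D \<and> A \<omega> \<in> B \<and> Y \<omega> = y}
      = emeasure M {\<omega> \<in> space M. (C \<omega>, Y \<omega>) \<in> D \<times> {y} \<and> A \<omega> \<in> B}"
    by (rule arg_cong[where f="emeasure M"]) auto
  also have "\<dots> = (\<integral>\<^sup>+x\<in>D \<times> {y}. emeasure (L x) B \<partial>distr M (U \<Otimes>\<^sub>M count_space T) (\<lambda>\<omega>. (C \<omega>, Y \<omega>)))"
    using y by (intro cond_lawD(3)[OF L] B) auto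
  also have "\<dots> = (\<integral>\<^sup>+\<omega>. emeasure (L (C \<omega>, Y \<omega>)) B * indicator (D \<times> {y}) (C \<omega>, Y \<omega>) \<partial>M)"
    using y L_meas by (subst nn_integral_distr) auto
  \<comment> \<open>On the event \<open>Y = y\<close> the kernel can be evaluated at the fixed
    class; what remains depends on \<open>C\<close> and that event only, so the posterior
    \<open>r\<close> given \<open>C\<close> takes over.\<close>
  also have "\<dots> = (\<integral>\<^sup>+\<omega>. (emeasure (L (C \<omega>, y)) B * indicator D (C \<omega>)) * indicator {y} (Y \<omega>) \<partial>M)"
    by (intro nn_integral_cong) (auto simp: indicator_def)
  also have "\<dots> = (\<integral>\<^sup>+c. ennreal (r y c) * (emeasure (L (c, y)) B * indicator D c) \<partial>distr M U C)"
    by (rule posterior_nn_integral[OF C Y r y]) measurable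
  finally show ?thesis by (simp add: mult.assoc)
qed

text \<open>The opposite order: \<open>A\<close> is drawn from its law given \<open>C\<close>, then
  the class from its posterior given \<open>C\<close> and \<open>A\<close>.\<close>

lemma cond_law_pair_class:
  assumes "prob_space M" and C[measurable]: "C \<in> measurable M U"
    and A[measurable]: "A \<in> measurable M N" and Y[measurable]: "Y \<in> measurable M (count_space T)"
    and K: "cond_law M N A U C K"
    and q: "posterior M (U \<Otimes>\<^sub>M N) (\<lambda>\<omega>. (C \<omega>, A \<omega>)) T Y q" and y: "y \<in> T"
    and D[measurable]: "D \<in> sets U" and B[measurable]: "B \<in> sets N"
  shows "emeasure M {\<omega> \<in> space M. C \<omega> \<in> D \<and> A \<omega> \<in> B \<and> Y \<omega> = y}
      = (\<integral>\<^sup>+c\<in>D. (\<integral>\<^sup>+a\<in>B. ennreal (q y (c, a)) \<partial>K c) \<partial>distr M U C)"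
proof -
  note [measurable] = posteriorD(1)[OF q y]
  have "emeasure M {\<omega> \<in> space M. C \<omega> \<in> D \<and> A \<omega> \<in> B \<and> Y \<omega> = y}
      = emeasure M {\<omega> \<in> space M. (C \<omega>, A \<omega>) \<in> D \<times> B \<and> Y \<omega> = y}"
    by (rule arg_cong[where f="emeasure M"]) auto
  also have "\<dots> = (\<integral>\<^sup>+x\<in>D \<times> B. ennreal (q y x) \<partial>distr M (U \<Otimes>\<^sub>M N) (\<lambda>\<omega>. (C \<omega>, A \<omega>)))"
    by (intro posteriorD(3)[OF q y]) auto
  also have "\<dots> = (\<integral>\<^sup>+\<omega>. ennreal (q y (C \<omega>, A \<omega>)) * indicator (D \<times> B) (C \<omega>, A \<omega>) \<partial>M)"
    by (subst nn_integral_distr) auto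
  also have "\<dots> = (\<integral>\<^sup>+c. \<integral>\<^sup>+a. ennreal (q y (c, a)) * indicator (D \<times> B) (c, a) \<partial>K c \<partial>distr M U C)"
    by (rule cond_law_nn_integral[OF assms(1) C A K, of "\<lambda>x. ennreal (q y x) * indicator (D \<times> B) x"]) measurable
  also have "\<dots> = (\<integral>\<^sup>+c\<in>D. (\<integral>\<^sup>+a\<in>B. ennreal (q y (c, a)) \<partial>K c) \<partial>distr M U C)"
    by (intro nn_integral_cong) (auto simp: indicator_def)
  finally show ?thesis .
qed

lemma measurable_cond_law_class:
  assumes K: "cond_law M N A U C K"
    and q: "posterior M (U \<Otimes>\<^sub>M N) (\<lambda>\<omega>. (C \<omega>, A \<omega>)) T Y q" and y: "y \<in> T"
    and B[measurable]: "B \<in> sets N"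
  shows "(\<lambda>c. \<integral>\<^sup>+a\<in>B. ennreal (q y (c, a)) \<partial>K c) \<in> borel_measurable U"
proof -
  note [measurable] = posteriorD(1)[OF q y] cond_lawD(2)[OF K]
  show ?thesis by (rule nn_integral_measurable_subprob_algebra2[where N=N]) measurable
qed

text \<open>Integrated over any \<open>D\<close>, both sides give the probability of
  \<open>C\<close> in \<open>D\<close>, \<open>A\<close> in \<open>B\<close> and
  \<open>Y = y\<close>. The rule is kept in multiplied form because \<open>r y c\<close> may vanish.
  The exceptional null set may depend on \<open>B\<close>.\<close>

lemma AE_cond_law_bayes:
  assumes "prob_space M" and C[measurable]: "C \<in> measurable M U"
    and A[measurable]: "A \<in> measurable M N" and Y[measurable]: "Y \<in> measurable M (count_space T)"
    and L: "cond_law M N A (U \<Otimes>\<^sub>M count_space T) (\<lambda>\<omega>. (C \<omega>, Y \<omega>)) L"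
    and K: "cond_law M N A U C K"
    and r: "posterior M U C T Y r"
    and q: "posterior M (U \<Otimes>\<^sub>M N) (\<lambda>\<omega>. (C \<omega>, A \<omega>)) T Y q" and y: "y \<in> T"
    and B: "B \<in> sets N"
  shows "AE c in distr M U C. ennreal (r y c) * emeasure (L (c, y)) B = (\<integral>\<^sup>+a\<in>B. ennreal (q y (c, a)) \<partial>K c)"
proof (rule AE_eq_of_set_nn_integral_eq[OF assms(1) C])
  have L_meas: "(\<lambda>x. emeasure (L x) B) \<in> borel_measurable (U \<Otimes>\<^sub>M count_space T)"
    using measurable_compose[OF cond_lawD(2)[OF L] measurable_emeasure_subprob_algebra[OF B]] .
  have [measurable]: "(\<lambda>c. emeasure (L (c, y)) B) \<in> borel_measurable U"
    using y by (intro measurable_compose[OF measurable_Pair2' L_meas]) simp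
  note [measurable] = posteriorD(1)[OF r y]
  show "(\<lambda>c. ennreal (r y c) * emeasure (L (c, y)) B) \<in> borel_measurable U" by measurable
  show "(\<lambda>c. \<integral>\<^sup>+a\<in>B. ennreal (q y (c, a)) \<partial>K c) \<in> borel_measurable U"
    by (rule measurable_cond_law_class[OF K q y B])
  show "(\<integral>\<^sup>+c\<in>D. ennreal (r y c) * emeasure (L (c, y)) B \<partial>distr M U C)
      = (\<integral>\<^sup>+c\<in>D. (\<integral>\<^sup>+a\<in>B. ennreal (q y (c, a)) \<partial>K c) \<partial>distr M U C)" if "D \<in> sets U" for D
    unfolding cond_law_class[OF assms(1) C A Y L r y that B, symmetric]
    by (rule cond_law_pair_class[OF assms(1) C A Y K q y that B])
qed

text \<open>Posteriors given \<open>C\<close> and \<open>A\<close> are integrated against the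
  conditional law of \<open>A\<close> alone; the first marginal of a kernel for the pair supplies
  that law.\<close>

lemma cond_law_fst:
  assumes "prob_space M" and C[measurable]: "C \<in> measurable M U"
    and A[measurable]: "A \<in> measurable M N" and Y[measurable]: "Y \<in> measurable M T"
    and K: "cond_law M (N \<Otimes>\<^sub>M T) (\<lambda>\<omega>. (A \<omega>, Y \<omega>)) U C K"
  shows "cond_law M N A U C (\<lambda>c. distr (K c) N fst)"
  unfolding cond_law_def
proof (intro conjI ballI)
  note KD = cond_lawD[OF K]
  show "(\<lambda>c. distr (K c) N fst) \<in> measurable U (prob_algebra N)"
    by (rule measurable_compose[OF KD(1) measurable_distr_prob_space]) measurable
  fix D B assume D[measurable]: "D \<in> sets U" and B[measurable]: "B \<in> sets N"
  have "{\<omega> \<in> space M. C \<omega> \<in> D \<and> A \<omega> \<in> B} = {\<omega> \<in> space M. C \<omega> \<in> D \<and> (A \<omega>, Y \<omega>) \<in> B \<times> space T}"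
    using measurable_space[OF Y] by auto
  then have "emeasure M {\<omega> \<in> space M. C \<omega> \<in> D \<and> A \<omega> \<in> B}
      = (\<integral>\<^sup>+c\<in>D. emeasure (K c) (B \<times> space T) \<partial>distr M U C)"
    using KD(3)[OF D, of "B \<times> space T"] by simp
  also have "\<dots> = (\<integral>\<^sup>+c\<in>D. emeasure (distr (K c) N fst) B \<partial>distr M U C)"
  proof (intro nn_integral_cong)
    fix c assume "c \<in> space (distr M U C)"
    then have c: "c \<in> space U" by simp
    note sets_eq = KD(5)[OF c]
    have "emeasure (distr (K c) N fst) B = emeasure (K c) (fst -` B \<inter> space (K c))"
      by (rule emeasure_distr[OF _ B]) (simp add: measurable_cong_sets[OF sets_eq refl])
    also have "fst -` B \<inter> space (K c) = B \<times> space T"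
      using sets.sets_into_space[OF B] by (auto simp: sets_eq_imp_space_eq[OF sets_eq] space_pair_measure)
    finally show "emeasure (K c) (B \<times> space T) * indicator D c = emeasure (distr (K c) N fst) B * indicator D c"
      by simp
  qed
  finally show "emeasure M {\<omega> \<in> space M. C \<omega> \<in> D \<and> A \<omega> \<in> B}
      = (\<integral>\<^sup>+c\<in>D. emeasure (distr (K c) N fst) B \<partial>distr M U C)" .
qed

text \<open>The classes partition the space, so over each \<open>D\<close> both sides integrate to
  \<open>P(C in D)\<close>.\<close>

lemma AE_sum_posterior_eq_1:
  assumes "prob_space M" and C[measurable]: "C \<in> measurable M U"
    and Y[measurable]: "Y \<in> measurable M (count_space T)" and T: "finite T"
    and r: "posterior M U C T Y r"
  shows "AE c in distr M U C. (\<Sum>y\<in>T. r y c) = 1"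
proof -
  have [measurable]: "r y \<in> borel_measurable U" if "y \<in> T" for y
    using posteriorD(1)[OF r that] .
  have "AE c in distr M U C. (\<Sum>y\<in>T. ennreal (r y c)) = 1"
  proof (rule AE_eq_of_set_nn_integral_eq[OF assms(1) C])
    fix D assume D[measurable]: "D \<in> sets U"
    have "(\<integral>\<^sup>+c\<in>D. (\<Sum>y\<in>T. ennreal (r y c)) \<partial>distr M U C) = (\<Sum>y\<in>T. (\<integral>\<^sup>+c\<in>D. ennreal (r y c) \<partial>distr M U C))"
      unfolding sum_distrib_right by (rule nn_integral_sum) auto
    also have "\<dots> = (\<Sum>y\<in>T. emeasure M {\<omega> \<in> space M. C \<omega> \<in> D \<and> Y \<omega> = y})"
      using posteriorD(3)[OF r _ D] by simp
    also have "\<dots> = emeasure M {\<omega> \<in> space M. C \<omega> \<in> D}"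
      by (intro emeasure_partition_finite[symmetric] Y T) measurable
    also have "\<dots> = (\<integral>\<^sup>+c\<in>D. 1 \<partial>distr M U C)"
      by (simp add: emeasure_distr) (auto intro!: arg_cong[where f="emeasure M"])
    finally show "(\<integral>\<^sup>+c\<in>D. (\<Sum>y\<in>T. ennreal (r y c)) \<partial>distr M U C) = (\<integral>\<^sup>+c\<in>D. 1 \<partial>distr M U C)" .
  qed measurable
  then show ?thesis
  proof eventually_elim
    case (elim c)
    then have "ennreal (\<Sum>y\<in>T. r y c) = ennreal 1" using posteriorD(2)[OF r] by simp
    then show ?case by (subst (asm) ennreal_inj) (auto intro: sum_nonneg posteriorD(2)[OF r])
  qed
qed

section \<open>Conditional mutual information\<close>

text \<open>
  The witness draws the class from its normalised posterior and then the variable from the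
  class-conditional law; where the posterior weights do not sum to 1 (a null set) the class is
  replaced by a fixed one.
\<close>

lemma cond_law_pair_exists:
  assumes "prob_space M" and C[measurable]: "C \<in> measurable M U"
    and A[measurable]: "A \<in> measurable M N" and Y[measurable]: "Y \<in> measurable M (count_space T)"
    and T: "finite T"
    and L: "cond_law M N A (U \<Otimes>\<^sub>M count_space T) (\<lambda>\<omega>. (C \<omega>, Y \<omega>)) L"
  shows "\<exists>K. cond_law M (N \<Otimes>\<^sub>M count_space T) (\<lambda>\<omega>. (A \<omega>, Y \<omega>)) U C K"
proof -
  interpret prob_space M by fact
  obtain r where r: "posterior M U C T Y r"
    using posterior_exists[OF assms(1) C Y] .
  have [measurable]: "r y \<in> borel_measurable U" if "y \<in> T" for y
    using posteriorD(1)[OF r that] .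
  \<comment> \<open>A fallback class exists because a probability space is nonempty and
    \<open>Y\<close> maps into \<open>T\<close>.\<close>
  obtain y0 where y0: "y0 \<in> T" using not_empty measurable_space[OF Y] by auto
  define w where "w = (\<lambda>c y. if (\<Sum>y\<in>T. r y c) = 1 then r y c else if y = y0 then 1 else 0)"
  have w_meas[measurable]: "(\<lambda>c. w c y) \<in> borel_measurable U" if "y \<in> T" for y
    using that unfolding w_def by measurable
  have w_nonneg: "0 \<le> w c y" if "y \<in> T" for c y
    using posteriorD(2)[OF r that] by (simp add: w_def)
  have w_sum: "(\<Sum>y\<in>T. w c y) = 1" for c
    using y0 T by (cases "(\<Sum>y\<in>T. r y c) = 1") (simp_all add: w_def)
  define R where "R = (\<lambda>c. density (count_space T) (\<lambda>y. ennreal (w c y)))"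
  have R_eq: "emeasure (R c) A = (\<Sum>y\<in>A. ennreal (w c y))" if "A \<subseteq> T" for c A
  proof -
    have "emeasure (R c) A = (\<Sum>y\<in>T. ennreal (w c y) * indicator A y)"
      unfolding R_def using that T by (simp add: emeasure_density nn_integral_count_space_finite)
    also have "\<dots> = (\<Sum>y\<in>A. ennreal (w c y))"
      using that T by (intro sum.mono_neutral_cong_right) auto
    finally show ?thesis .
  qed
  have R_nn: "(\<integral>\<^sup>+y. f y \<partial>R c) = (\<Sum>y\<in>T. ennreal (w c y) * f y)" for f c
    unfolding R_def using T by (simp add: nn_integral_density nn_integral_count_space_finite)
  have R_prob: "prob_space (R c)" for c
  proof
    have "emeasure (R c) (space (R c)) = ennreal (\<Sum>y\<in>T. w c y)"
      using R_eq[of T c] w_nonneg by (simp add: R_def)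
    then show "emeasure (R c) (space (R c)) = 1" by (simp add: w_sum)
  qed
  have R: "R \<in> measurable U (prob_algebra (count_space T))"
  proof (rule measurable_prob_algebraI[OF R_prob measurable_subprob_algebra])
    show "subprob_space (R c)" for c by (rule prob_space_imp_subprob_space[OF R_prob])
    show "sets (R c) = sets (count_space T)" for c by (simp add: R_def)
    fix B assume "B \<in> sets (count_space T)"
    then have B: "B \<subseteq> T" by simp
    show "(\<lambda>c. emeasure (R c) B) \<in> borel_measurable U"
      unfolding R_eq[OF B] using B by (intro borel_measurable_sum) auto
  qed
  note LD = cond_lawD[OF L]
  define K where "K = (\<lambda>c. R c \<bind> (\<lambda>y. distr (L (c, y)) (N \<Otimes>\<^sub>M count_space T) (\<lambda>a. (a, y))))"
  have inner: "(\<lambda>(c, y). distr (L (c, y)) (N \<Otimes>\<^sub>M count_space T) (\<lambda>a. (a, y)))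
      \<in> measurable (U \<Otimes>\<^sub>M count_space T) (prob_algebra (N \<Otimes>\<^sub>M count_space T))"
  proof -
    have "(\<lambda>x. distr (L x) (N \<Otimes>\<^sub>M count_space T) (\<lambda>a. (a, snd x)))
        \<in> measurable (U \<Otimes>\<^sub>M count_space T) (prob_algebra (N \<Otimes>\<^sub>M count_space T))"
      by (rule measurable_distr_prob_space2[OF LD(1)]) measurable
    then show ?thesis by (simp add: case_prod_beta')
  qed
  have K_meas: "K \<in> measurable U (prob_algebra (N \<Otimes>\<^sub>M count_space T))"
    unfolding K_def by (rule measurable_bind_prob_space2[OF R inner])
  have slice: "{a \<in> space N. (a, y) \<in> B} \<in> sets N" if "B \<in> sets (N \<Otimes>\<^sub>M count_space T)" "y \<in> T" for B y
  proof -
    have "(\<lambda>a. (a, y)) \<in> measurable N (N \<Otimes>\<^sub>M count_space T)" using that(2) by (intro measurable_Pair2') simp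
    from measurable_sets[OF this that(1)] show ?thesis
      by (rule back_subst[where P="\<lambda>A. A \<in> sets N"]) auto
  qed
  have K_eq: "emeasure (K c) B = (\<Sum>y\<in>T. ennreal (w c y) * emeasure (L (c, y)) {a \<in> space N. (a, y) \<in> B})"
    if c: "c \<in> space U" and B: "B \<in> sets (N \<Otimes>\<^sub>M count_space T)" for c B
  proof -
    have "emeasure (K c) B = (\<integral>\<^sup>+y. emeasure (distr (L (c, y)) (N \<Otimes>\<^sub>M count_space T) (\<lambda>a. (a, y))) B \<partial>R c)"
      unfolding K_def
    proof (rule emeasure_bind_prob_algebra[OF measurable_space[OF R c] _ B])
      show "(\<lambda>y. distr (L (c, y)) (N \<Otimes>\<^sub>M count_space T) (\<lambda>a. (a, y)))
        \<in> measurable (count_space T) (prob_algebra (N \<Otimes>\<^sub>M count_space T))"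
        using measurable_compose[OF measurable_Pair1'[OF c] inner] by simp
    qed
    also have "\<dots> = (\<Sum>y\<in>T. ennreal (w c y) * emeasure (distr (L (c, y)) (N \<Otimes>\<^sub>M count_space T) (\<lambda>a. (a, y))) B)"
      by (rule R_nn)
    also have "\<dots> = (\<Sum>y\<in>T. ennreal (w c y) * emeasure (L (c, y)) {a \<in> space N. (a, y) \<in> B})"
    proof (intro sum.cong refl arg_cong2[where f="(*)"])
      fix y assume y: "y \<in> T"
      have sets_eq: "sets (L (c, y)) = sets N" using LD(5)[of "(c, y)"] c y by (simp add: space_pair_measure)
      have "emeasure (distr (L (c, y)) (N \<Otimes>\<^sub>M count_space T) (\<lambda>a. (a, y))) B
          = emeasure (L (c, y)) ((\<lambda>a. (a, y)) -` B \<inter> space (L (c, y)))"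
      proof (rule emeasure_distr[OF _ B])
        show "(\<lambda>a. (a, y)) \<in> measurable (L (c, y)) (N \<Otimes>\<^sub>M count_space T)"
          unfolding measurable_cong_sets[OF sets_eq refl] using y by (intro measurable_Pair2') simp
      qed
      also have "(\<lambda>a. (a, y)) -` B \<inter> space (L (c, y)) = {a \<in> space N. (a, y) \<in> B}"
        by (auto simp: sets_eq_imp_space_eq[OF sets_eq])
      finally show "emeasure (distr (L (c, y)) (N \<Otimes>\<^sub>M count_space T) (\<lambda>a. (a, y))) B
          = emeasure (L (c, y)) {a \<in> space N. (a, y) \<in> B}" .
    qed
    finally show ?thesis .
  qed
  \<comment> \<open>The fallback branch of \<open>w\<close> is confined to a null set, so
    \<open>w\<close> and \<open>r\<close> are interchangeable under the integral.\<close>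
  have ae_w: "AE c in distr M U C. \<forall>y\<in>T. w c y = r y c"
    using AE_sum_posterior_eq_1[OF assms(1) C Y T r] by eventually_elim (simp add: w_def)
  have "cond_law M (N \<Otimes>\<^sub>M count_space T) (\<lambda>\<omega>. (A \<omega>, Y \<omega>)) U C K"
    unfolding cond_law_def
  proof (intro conjI ballI K_meas)
    fix D B assume D[measurable]: "D \<in> sets U" and B[measurable]: "B \<in> sets (N \<Otimes>\<^sub>M count_space T)"
    have meas: "(\<lambda>c. ennreal (r y c) * emeasure (L (c, y)) {a \<in> space N. (a, y) \<in> B}) \<in> borel_measurable U"
      if y[measurable]: "y \<in> T" for y
    proof -
      have L_meas: "(\<lambda>x. emeasure (L x) {a \<in> space N. (a, y) \<in> B}) \<in> borel_measurable (U \<Otimes>\<^sub>M count_space T)"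
        by (rule measurable_compose[OF LD(2) measurable_emeasure_subprob_algebra[OF slice[OF B y]]])
      have [measurable]: "(\<lambda>c. emeasure (L (c, y)) {a \<in> space N. (a, y) \<in> B}) \<in> borel_measurable U"
        using y by (intro measurable_compose[OF measurable_Pair2' L_meas]) simp
      show ?thesis by measurable
    qed
    have "emeasure M {\<omega> \<in> space M. C \<omega> \<in> D \<and> (A \<omega>, Y \<omega>) \<in> B}
        = (\<Sum>y\<in>T. emeasure M {\<omega> \<in> space M. (C \<omega> \<in> D \<and> (A \<omega>, Y \<omega>) \<in> B) \<and> Y \<omega> = y})"
      by (intro emeasure_partition_finite Y T) measurable
    also have "\<dots> = (\<Sum>y\<in>T. emeasure M {\<omega> \<in> space M. C \<omega> \<in> D \<and> A \<omega> \<in> {a \<in> space N. (a, y) \<in> B} \<and> Y \<omega> = y})"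
      using measurable_space[OF A] by (intro sum.cong refl arg_cong[where f="emeasure M"]) auto
    also have "\<dots> = (\<Sum>y\<in>T. \<integral>\<^sup>+c\<in>D. ennreal (r y c) * emeasure (L (c, y)) {a \<in> space N. (a, y) \<in> B} \<partial>distr M U C)"
      by (intro sum.cong refl cond_law_class[OF assms(1) C A Y L r _ D slice[OF B]])
    also have "\<dots> = (\<integral>\<^sup>+c\<in>D. (\<Sum>y\<in>T. ennreal (r y c) * emeasure (L (c, y)) {a \<in> space N. (a, y) \<in> B}) \<partial>distr M U C)"
      unfolding sum_distrib_right using meas by (subst nn_integral_sum) auto
    also have "\<dots> = (\<integral>\<^sup>+c\<in>D. emeasure (K c) B \<partial>distr M U C)"
    proof (intro nn_integral_cong_AE)
      show "AE c in distr M U C. (\<Sum>y\<in>T. ennreal (r y c) * emeasure (L (c, y)) {a \<in> space N. (a, y) \<in> B}) * indicator D c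
          = emeasure (K c) B * indicator D c"
        using ae_w AE_space by eventually_elim (simp add: K_eq[OF _ B])
    qed
    finally show "emeasure M {\<omega> \<in> space M. C \<omega> \<in> D \<and> (A \<omega>, Y \<omega>) \<in> B}
        = (\<integral>\<^sup>+c\<in>D. emeasure (K c) B \<partial>distr M U C)" .
  qed
  then show ?thesis by (rule exI[of _ K])
qed

text \<open>
  Versions of a conditional law agree almost everywhere on a fixed set; the countably many half-lines
  with rational end point make the exceptional null set independent of the set.
\<close>

lemma AE_posterior_cond_law:
  assumes "prob_space M" and C[measurable]: "C \<in> measurable M U"
    and A[measurable]: "A \<in> borel_measurable M" and Y[measurable]: "Y \<in> measurable M (count_space T)"
    and T: "finite T"
    and K: "cond_law M (borel \<Otimes>\<^sub>M count_space T) (\<lambda>\<omega>. (A \<omega>, Y \<omega>)) U C K"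
    and q: "posterior M (U \<Otimes>\<^sub>M borel) (\<lambda>\<omega>. (C \<omega>, A \<omega>)) T Y q"
  shows "AE c in distr M U C. posterior (K c) (borel :: real measure) fst T snd (\<lambda>y a. q y (c, a))"
proof -
  note KD = cond_lawD[OF K]
  have K1: "cond_law M borel A U C (\<lambda>c. distr (K c) borel fst)"
    by (rule cond_law_fst[OF assms(1) C A Y K])
  have rat: "AE c in distr M U C. emeasure (K c) (B \<times> {y}) = (\<integral>\<^sup>+a\<in>B. ennreal (q y (c, a)) \<partial>distr (K c) borel fst)"
    if y: "y \<in> T" and B[measurable]: "B \<in> sets borel" for y B
  proof (rule AE_eq_of_set_nn_integral_eq[OF assms(1) C])
    have By: "B \<times> {y} \<in> sets (borel \<Otimes>\<^sub>M count_space T)" using y by auto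
    show "(\<lambda>c. emeasure (K c) (B \<times> {y})) \<in> borel_measurable U"
      by (rule measurable_compose[OF KD(2) measurable_emeasure_subprob_algebra[OF By]])
    show "(\<lambda>c. \<integral>\<^sup>+a\<in>B. ennreal (q y (c, a)) \<partial>distr (K c) borel fst) \<in> borel_measurable U"
      by (rule measurable_cond_law_class[OF K1 q y B])
    fix D assume D: "D \<in> sets U"
    have "(\<integral>\<^sup>+c\<in>D. emeasure (K c) (B \<times> {y}) \<partial>distr M U C) = emeasure M {\<omega> \<in> space M. C \<omega> \<in> D \<and> A \<omega> \<in> B \<and> Y \<omega> = y}"
      using KD(3)[OF D By] by simp
    also have "\<dots> = (\<integral>\<^sup>+c\<in>D. (\<integral>\<^sup>+a\<in>B. ennreal (q y (c, a)) \<partial>distr (K c) borel fst) \<partial>distr M U C)"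
      by (rule cond_law_pair_class[OF assms(1) C A Y K1 q y D B])
    finally show "(\<integral>\<^sup>+c\<in>D. emeasure (K c) (B \<times> {y}) \<partial>distr M U C)
      = (\<integral>\<^sup>+c\<in>D. (\<integral>\<^sup>+a\<in>B. ennreal (q y (c, a)) \<partial>distr (K c) borel fst) \<partial>distr M U C)" .
  qed
  \<comment> \<open>\<open>UNIV\<close> joins the half-lines so that \<nu> inherits finiteness from
    \<mu> below; only then do the half-lines determine it.\<close>
  have "AE c in distr M U C. \<forall>y\<in>T. \<forall>t\<in>insert UNIV (atMost ` \<rat>). emeasure (K c) (t \<times> {y}) = (\<integral>\<^sup>+a\<in>t. ennreal (q y (c, a)) \<partial>distr (K c) borel fst)"
    using T by (intro AE_ball_countable' rat) (auto intro: countable_finite countable_rat)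
  then show ?thesis
    using AE_space
  proof eventually_elim
    case (elim c)
    then have c: "c \<in> space U" by simp
    interpret Kc: prob_space "K c" by (rule KD(4)[OF c])
    have sets_K[measurable_cong]: "sets (K c) = sets (borel \<Otimes>\<^sub>M count_space T)" by (rule KD(5)[OF c])
    have space_K: "space (K c) = UNIV \<times> T"
      using sets_eq_imp_space_eq[OF sets_K] by (simp add: space_pair_measure)
    show ?case
      unfolding posterior_def
    proof (intro ballI conjI allI)
      fix y assume y: "y \<in> T"
      show q_meas[measurable]: "(\<lambda>a. q y (c, a)) \<in> borel_measurable borel"
        using measurable_compose[OF measurable_Pair1'[OF c] posteriorD(1)[OF q y]] .
      show "0 \<le> q y (c, a)" for a by (rule posteriorD(2)[OF q y])
      \<comment> \<open>\<mu> is the part of \<open>K c\<close> lying in class \<open>y\<close>,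
        projected to the line; \<nu> is what the candidate posterior \<open>q y (c, a)\<close>
        predicts for it.\<close>
      define \<mu> where "\<mu> = distr (density (K c) (indicator (UNIV \<times> {y}))) borel fst"
      define \<nu> where "\<nu> = density (distr (K c) borel fst) (\<lambda>a. ennreal (q y (c, a)))"
      have [measurable]: "UNIV \<times> {y} \<in> sets (K c)" using y unfolding sets_K by auto
      have \<mu>: "emeasure \<mu> B = emeasure (K c) (B \<times> {y})" if [measurable]: "B \<in> sets borel" for B
      proof -
        have "emeasure \<mu> B = emeasure (K c) {z \<in> space (K c). fst z \<in> B \<and> z \<in> UNIV \<times> {y}}"
          unfolding \<mu>_def by (rule emeasure_distr_restricted) auto
        also have "{z \<in> space (K c). fst z \<in> B \<and> z \<in> UNIV \<times> {y}} = B \<times> {y}"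
          using y by (auto simp: space_K)
        finally show ?thesis .
      qed
      have \<nu>: "emeasure \<nu> B = (\<integral>\<^sup>+a\<in>B. ennreal (q y (c, a)) \<partial>distr (K c) borel fst)" if "B \<in> sets borel" for B
        unfolding \<nu>_def using that by (subst emeasure_density) auto
      have fin: "finite_measure \<mu>"
        by (rule finite_measureI) (simp add: \<mu>_def[THEN arg_cong[where f=space]] \<mu>)
      have eq: "emeasure \<mu> B = emeasure \<nu> B" if "B \<in> insert UNIV (atMost ` \<rat>)" for B
        using elim(1) y that by (subst \<mu>, blast intro: borel_closed, subst \<nu>) auto
      have "\<mu> = \<nu>"
      proof (rule measure_eqI_atMost_rat[OF fin])
        show "finite_measure \<nu>"
          using finite_measure.emeasure_finite[OF fin, of UNIV] eq[of UNIV]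
          by (intro finite_measureI) (simp add: \<nu>_def[THEN arg_cong[where f=space]])
        show "sets \<mu> = sets borel" "sets \<nu> = sets borel" by (simp_all add: \<mu>_def \<nu>_def)
        show "emeasure \<mu> {..r} = emeasure \<nu> {..r}" if "r \<in> \<rat>" for r using that by (intro eq) auto
      qed
      fix B :: "real set" assume B: "B \<in> sets borel"
      have "{z \<in> space (K c). fst z \<in> B \<and> snd z = y} = B \<times> {y}" using y by (auto simp: space_K)
      then show "emeasure (K c) {z \<in> space (K c). fst z \<in> B \<and> snd z = y}
          = (\<integral>\<^sup>+a\<in>B. ennreal (q y (c, a)) \<partial>distr (K c) borel fst)"
        using \<mu>[OF B] \<nu>[OF B] \<open>\<mu> = \<nu>\<close> by simp
    qed
  qed
qed

text \<open>Under \<open>K c\<close> the class probabilities are the prior in the inner mutual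
  information; identifying them with \<open>r\<close> produces the denominator
  \<open>P(Y | C)\<close>.\<close>

lemma AE_class_prob_cond_law:
  assumes "prob_space M" and C[measurable]: "C \<in> measurable M U"
    and A[measurable]: "A \<in> measurable M N" and Y[measurable]: "Y \<in> measurable M (count_space T)"
    and T: "finite T"
    and K: "cond_law M (N \<Otimes>\<^sub>M count_space T) (\<lambda>\<omega>. (A \<omega>, Y \<omega>)) U C K"
    and r: "posterior M U C T Y r"
  shows "AE c in distr M U C. \<forall>y\<in>T. measure (K c) {z \<in> space (K c). snd z = y} = r y c"
proof -
  note KD = cond_lawD[OF K]
  have "AE c in distr M U C. emeasure (K c) (space N \<times> {y}) = ennreal (r y c)" if y: "y \<in> T" for y
  proof (rule AE_eq_of_set_nn_integral_eq[OF assms(1) C])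
    have By: "space N \<times> {y} \<in> sets (N \<Otimes>\<^sub>M count_space T)" using y by auto
    show "(\<lambda>c. emeasure (K c) (space N \<times> {y})) \<in> borel_measurable U"
      by (rule measurable_compose[OF KD(2) measurable_emeasure_subprob_algebra[OF By]])
    show "(\<lambda>c. ennreal (r y c)) \<in> borel_measurable U"
      using posteriorD(1)[OF r y] by simp
    fix D assume D: "D \<in> sets U"
    have "(\<integral>\<^sup>+c\<in>D. emeasure (K c) (space N \<times> {y}) \<partial>distr M U C) = emeasure M {\<omega> \<in> space M. C \<omega> \<in> D \<and> Y \<omega> = y}"
      using measurable_space[OF A]
      by (subst KD(3)[OF D By, symmetric]) (auto intro!: arg_cong[where f="emeasure M"])
    then show "(\<integral>\<^sup>+c\<in>D. emeasure (K c) (space N \<times> {y}) \<partial>distr M U C) = (\<integral>\<^sup>+c\<in>D. ennreal (r y c) \<partial>distr M U C)"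
      using posteriorD(3)[OF r y D] by simp
  qed
  then have "AE c in distr M U C. \<forall>y\<in>T. emeasure (K c) (space N \<times> {y}) = ennreal (r y c)"
    using T by (intro AE_ball_countable') (auto intro: countable_finite)
  then show ?thesis
    using AE_space
  proof eventually_elim
    case (elim c)
    show ?case
    proof
      fix y assume y: "y \<in> T"
      have "{z \<in> space (K c). snd z = y} = space N \<times> {y}"
        using y elim(2) sets_eq_imp_space_eq[OF KD(5)[of c]] by (auto simp: space_pair_measure)
      then show "measure (K c) {z \<in> space (K c). snd z = y} = r y c"
        using elim(1) y posteriorD(2)[OF r y] by (simp add: measure_def)
    qed
  qed
qed

text \<open>For almost every \<open>c\<close>, \<open>mutual_information_posterior\<close> applies
  to the two coordinates under \<open>K c\<close>, with posterior \<open>q y (c, a)\<close> and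
  prior \<open>r y c\<close>; disintegration turns the average over \<open>c\<close> into an
  expectation over \<open>M\<close>. The result does not mention the kernel, so the choice made by
  \<open>SOME\<close> is immaterial.\<close>

lemma cond_mutual_info_posterior:
  assumes "prob_space M" and C[measurable]: "C \<in> measurable M U"
    and A[measurable]: "A \<in> borel_measurable M" and Y[measurable]: "Y \<in> measurable M (count_space T)"
    and T: "finite T" and b: "1 < b"
    and ex: "\<exists>K. cond_law M (borel \<Otimes>\<^sub>M count_space T) (\<lambda>\<omega>. (A \<omega>, Y \<omega>)) U C K"
    and q: "posterior M (U \<Otimes>\<^sub>M borel) (\<lambda>\<omega>. (C \<omega>, A \<omega>)) T Y q"
    and r: "posterior M U C T Y r"
  shows "cond_mutual_info b M (borel :: real measure) (count_space T) U A Y C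
      = (\<integral>\<omega>. log b (q (Y \<omega>) (C \<omega>, A \<omega>)) - log b (r (Y \<omega>) (C \<omega>)) \<partial>M)"
proof -
  define K where "K = (SOME K. cond_law M (borel \<Otimes>\<^sub>M count_space T) (\<lambda>\<omega>. (A \<omega>, Y \<omega>)) U C K)"
  have K: "cond_law M (borel \<Otimes>\<^sub>M count_space T) (\<lambda>\<omega>. (A \<omega>, Y \<omega>)) U C K"
    unfolding K_def by (rule someI_ex[OF ex])
  note KD = cond_lawD[OF K]
  define f where "f = (\<lambda>(c, a, y). log b (q y (c, a)) - log b (r y c))"
  have mq: "(\<lambda>(x, y). q y x) \<in> borel_measurable ((U \<Otimes>\<^sub>M borel) \<Otimes>\<^sub>M count_space T)"
    by (rule measurable_posterior[OF q T])
  have mr: "(\<lambda>(x, y). r y x) \<in> borel_measurable (U \<Otimes>\<^sub>M count_space T)"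
    by (rule measurable_posterior[OF r T])
  have [measurable]: "(\<lambda>x. q (snd (snd x)) (fst x, fst (snd x))) \<in> borel_measurable (U \<Otimes>\<^sub>M borel \<Otimes>\<^sub>M count_space T)"
    using measurable_compose[OF _ mq, of "\<lambda>x. ((fst x, fst (snd x)), snd (snd x))" "U \<Otimes>\<^sub>M borel \<Otimes>\<^sub>M count_space T"] by simp
  have [measurable]: "(\<lambda>x. r (snd (snd x)) (fst x)) \<in> borel_measurable (U \<Otimes>\<^sub>M (borel :: real measure) \<Otimes>\<^sub>M count_space T)"
    using measurable_compose[OF _ mr, of "\<lambda>x. (fst x, snd (snd x))" "U \<Otimes>\<^sub>M borel \<Otimes>\<^sub>M count_space T"] by simp
  have f: "f \<in> borel_measurable (U \<Otimes>\<^sub>M borel \<Otimes>\<^sub>M count_space T)"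
    unfolding f_def case_prod_beta' by measurable
  have int: "integrable M (\<lambda>\<omega>. f (C \<omega>, A \<omega>, Y \<omega>))"
    unfolding f_def
    using Bochner_Integration.integrable_diff[OF posterior_integrable_log[OF assms(1) _ Y T q b] posterior_integrable_log[OF assms(1) C Y T r b]]
    by simp
  have "AE c in distr M U C. prob_space.mutual_information (K c) b borel (count_space T) fst snd = (\<integral>z. f (c, z) \<partial>K c)
      \<and> integrable (K c) (\<lambda>z. f (c, z)) \<and> 0 \<le> (\<integral>z. f (c, z) \<partial>K c)"
    using AE_posterior_cond_law[OF assms(1) C A Y T K q] AE_class_prob_cond_law[OF assms(1) C A Y T K r] AE_space
  proof eventually_elim
    case (elim c)
    then have c: "c \<in> space U" by simp
    note prob = KD(4)[OF c]
    note cong = measurable_cong_sets[OF KD(5)[OF c] refl]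
    have m: "fst \<in> measurable (K c) borel" "snd \<in> measurable (K c) (count_space T)"
      by (simp_all add: cong)
    \<comment> \<open>The identity is confined to the space of \<open>K c\<close> because the class
      probabilities are known only for classes in \<open>T\<close>.\<close>
    have eq: "(\<lambda>z. f (c, z)) z = log b (q (snd z) (c, fst z)) - log b (measure (K c) {z' \<in> space (K c). snd z' = snd z})"
      if "z \<in> space (K c)" for z
      using that elim(2) measurable_space[OF m(2) that] by (auto simp: f_def case_prod_beta)
    have "(\<integral>z. f (c, z) \<partial>K c) = prob_space.mutual_information (K c) b borel (count_space T) fst snd"
      unfolding mutual_information_posterior[OF prob m T elim(1) b]
      by (rule Bochner_Integration.integral_cong[OF refl eq])
    moreover have "integrable (K c) (\<lambda>z. f (c, z))"
      using Bochner_Integration.integrable_diff[OF posterior_integrable_log[OF prob m T elim(1) b] integrable_log_class_prob[OF prob m T elim(1) b]]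
      by (subst Bochner_Integration.integrable_cong[OF refl eq])
    ultimately show ?case
      using mutual_information_finite_nonneg[OF prob m T elim(1) b] by simp
  qed
  note ae = this
  have "cond_mutual_info b M borel (count_space T) U A Y C
      = enn2real (\<integral>\<^sup>+c. ennreal (prob_space.mutual_information (K c) b borel (count_space T) fst snd) \<partial>distr M U C)"
    unfolding cond_mutual_info_def K_def Let_def ..
  also have "\<dots> = enn2real (\<integral>\<^sup>+c. ennreal (\<integral>z. f (c, z) \<partial>K c) \<partial>distr M U C)"
    using ae by (intro arg_cong[where f=enn2real] nn_integral_cong_AE) auto
  also have "\<dots> = (\<integral>\<omega>. f (C \<omega>, A \<omega>, Y \<omega>) \<partial>M)"
    using ae by (intro cond_law_integral[OF assms(1) C _ K f int]) auto
  finally show ?thesis by (simp add: f_def)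
qed

section \<open>The posterior under conditional independence\<close>

text \<open>\<open>product_sigma_finite\<close> speaks of every index, whereas the kernels are
  controlled only on \<open>J\<close>. Off \<open>J\<close> the zero measure
  \<open>count_space {}\<close> is substituted, and \<open>PiM J\<close> does not see the
  change.\<close>

lemma product_sigma_finite_extend:
  assumes "\<And>j. j \<in> J \<Longrightarrow> sigma_finite_measure (\<kappa> j)"
  obtains \<kappa>' where "product_sigma_finite \<kappa>'" "\<And>j. j \<in> J \<Longrightarrow> \<kappa>' j = \<kappa> j"
proof
  show "product_sigma_finite (\<lambda>j. if j \<in> J then \<kappa> j else count_space {})"
    unfolding product_sigma_finite_def using assms
    by (auto intro: sigma_finite_measure_count_space_finite)
qed simp

lemma nn_integral_PiM_prod:
  assumes J: "finite J" and sf: "\<And>j. j \<in> J \<Longrightarrow> sigma_finite_measure (\<kappa> j)"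
    and f: "\<And>j. j \<in> J \<Longrightarrow> f j \<in> borel_measurable (\<kappa> j)"
  shows "(\<integral>\<^sup>+x. (\<Prod>j\<in>J. f j (x j)) \<partial>PiM J \<kappa>) = (\<Prod>j\<in>J. \<integral>\<^sup>+a. f j a \<partial>\<kappa> j)"
proof -
  obtain \<kappa>' where \<kappa>': "product_sigma_finite \<kappa>'" "\<And>j. j \<in> J \<Longrightarrow> \<kappa>' j = \<kappa> j"
    using product_sigma_finite_extend[of J \<kappa>] sf by blast
  have "PiM J \<kappa> = PiM J \<kappa>'" using \<kappa>'(2) by (intro PiM_cong) auto
  moreover have "(\<integral>\<^sup>+x. (\<Prod>j\<in>J. f j (x j)) \<partial>PiM J \<kappa>') = (\<Prod>j\<in>J. \<integral>\<^sup>+a. f j a \<partial>\<kappa>' j)"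
    using \<kappa>'(2) f by (intro product_sigma_finite.product_nn_integral_prod[OF \<kappa>'(1) J]) auto
  ultimately show ?thesis using \<kappa>'(2) by simp
qed

lemma emeasure_PiM_box:
  assumes J: "finite J" and sf: "\<And>j. j \<in> J \<Longrightarrow> sigma_finite_measure (\<kappa> j)"
    and A: "\<And>j. j \<in> J \<Longrightarrow> A j \<in> sets (\<kappa> j)"
  shows "emeasure (PiM J \<kappa>) (Pi\<^sub>E J A) = (\<Prod>j\<in>J. emeasure (\<kappa> j) (A j))"
proof -
  obtain \<kappa>' where \<kappa>': "product_sigma_finite \<kappa>'" "\<And>j. j \<in> J \<Longrightarrow> \<kappa>' j = \<kappa> j"
    using product_sigma_finite_extend[of J \<kappa>] sf by blast
  have "PiM J \<kappa> = PiM J \<kappa>'" using \<kappa>'(2) by (intro PiM_cong) auto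
  moreover have "emeasure (PiM J \<kappa>') (Pi\<^sub>E J A) = (\<Prod>j\<in>J. emeasure (\<kappa>' j) (A j))"
    using \<kappa>'(2) A by (intro product_sigma_finite.emeasure_PiM[OF \<kappa>'(1) J]) auto
  ultimately show ?thesis using \<kappa>'(2) by simp
qed

text \<open>
  By conditional independence within each class, the posterior given all variables is the posterior
  \<open>r\<close> given \<open>X i\<close> reweighted by one likelihood ratio per \<open>j\<close>, each of which is \<open>q j / r\<close> by Bayes'
  rule; at points with \<open>r y (x i) = 0\<close> the product vanishes whatever the junk quotients are.
\<close>

lemma posterior_cond_indep:
  fixes X :: "'i \<Rightarrow> 'a \<Rightarrow> 'b" and N :: "'i \<Rightarrow> 'b measure"
  assumes "prob_space M" and J: "finite J" "i \<notin> J"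
    and X[measurable]: "\<And>j. j \<in> insert i J \<Longrightarrow> X j \<in> measurable M (N j)"
    and Y[measurable]: "Y \<in> measurable M (count_space T)"
    and K: "\<And>j. j \<in> J \<Longrightarrow> cond_law M (N j) (X j) (N i) (X i) (K j)"
    and KJ: "cond_law M (PiM J N) (\<lambda>\<omega>. \<lambda>j\<in>J. X j \<omega>) (N i) (X i) (\<lambda>c. PiM J (\<lambda>j. K j c))"
    and L: "\<And>j. j \<in> J \<Longrightarrow> cond_law M (N j) (X j) (N i \<Otimes>\<^sub>M count_space T) (\<lambda>\<omega>. (X i \<omega>, Y \<omega>)) (L j)"
    and LJ: "cond_law M (PiM J N) (\<lambda>\<omega>. \<lambda>j\<in>J. X j \<omega>) (N i \<Otimes>\<^sub>M count_space T) (\<lambda>\<omega>. (X i \<omega>, Y \<omega>))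
      (\<lambda>c. PiM J (\<lambda>j. L j c))"
    and r: "posterior M (N i) (X i) T Y r"
    and q: "\<And>j. j \<in> J \<Longrightarrow> posterior M (N i \<Otimes>\<^sub>M N j) (\<lambda>\<omega>. (X i \<omega>, X j \<omega>)) T Y (q j)"
  shows "posterior M (PiM (insert i J) N) (\<lambda>\<omega>. \<lambda>j\<in>insert i J. X j \<omega>) T Y
    (\<lambda>y x. r y (x i) * (\<Prod>j\<in>J. q j y (x i, x j) / r y (x i)))"
    (is "posterior M ?P ?Z T Y ?g")
  unfolding posterior_def
proof (intro ballI conjI allI)
  interpret prob_space M by fact
  have Xi[measurable]: "X i \<in> measurable M (N i)" by (rule X) simp
  have XJ[measurable]: "(\<lambda>\<omega>. \<lambda>j\<in>J. X j \<omega>) \<in> measurable M (PiM J N)"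
    by (intro measurable_restrict X) simp
  have Z[measurable]: "?Z \<in> measurable M ?P"
    by (intro measurable_restrict X)
  fix y assume y: "y \<in> T"
  note ry[measurable] = posteriorD(1)[OF r y]
  have r_nonneg: "0 \<le> r y c" for c by (rule posteriorD(2)[OF r y])
  have qy: "q j y \<in> borel_measurable (N i \<Otimes>\<^sub>M N j)" "0 \<le> q j y c" if "j \<in> J" for j c
    using posteriorD(1,2)[OF q[OF that] y] by auto
  note [measurable] = qy(1)
  have [measurable]: "(\<lambda>x. q j y (x i, x j)) \<in> borel_measurable ?P" if "j \<in> J" for j
    using that by (intro measurable_compose[OF _ qy(1)[OF that]]) measurable
  have [measurable]: "(\<lambda>x. r y (x i)) \<in> borel_measurable ?P"
    by (intro measurable_compose[OF _ ry] measurable_component_singleton) simp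
  show g_meas[measurable]: "?g y \<in> borel_measurable ?P" by measurable
  show "0 \<le> ?g y x" for x
    using qy(2) r_nonneg by (intro mult_nonneg_nonneg prod_nonneg divide_nonneg_nonneg) auto
  define E where "E = {\<omega> \<in> space M. Y \<omega> = y}"
  have E[measurable]: "E \<in> sets M" unfolding E_def by (rule sets_eq_count_space[OF Y])
  \<comment> \<open>The true measure of the class and the one predicted by the candidate posterior
    are compared on boxes only, where the product structure can be used.\<close>
  define \<mu> where "\<mu> = distr (density M (indicator E)) ?P ?Z"
  define \<nu> where "\<nu> = density (distr M ?P ?Z) (\<lambda>x. ennreal (?g y x))"
  have \<mu>: "emeasure \<mu> B = emeasure M {\<omega> \<in> space M. ?Z \<omega> \<in> B \<and> Y \<omega> = y}" if "B \<in> sets ?P" for B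
    unfolding \<mu>_def using that
    by (subst emeasure_distr_restricted[OF Z E]) (auto simp: E_def intro!: arg_cong[where f="emeasure M"])
  have \<nu>: "emeasure \<nu> B = (\<integral>\<^sup>+x\<in>B. ennreal (?g y x) \<partial>distr M ?P ?Z)" if "B \<in> sets ?P" for B
    unfolding \<nu>_def using that by (subst emeasure_density) auto
  have "\<mu> = \<nu>"
  proof (rule measure_eqI_PiM_finite)
    show "finite (insert i J)" "sets \<mu> = sets ?P" "sets \<nu> = sets ?P"
      using J by (simp_all add: \<mu>_def \<nu>_def)
    show "range (\<lambda>_::nat. Pi\<^sub>E (insert i J) (\<lambda>j. space (N j))) \<subseteq> prod_algebra (insert i J) N"
      using J by (auto intro!: prod_algebraI_finite)
    show "(\<Union>n::nat. Pi\<^sub>E (insert i J) (\<lambda>j. space (N j))) = space ?P"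
      by (simp add: space_PiM)
    show "emeasure \<mu> (Pi\<^sub>E (insert i J) (\<lambda>j. space (N j))) \<noteq> \<infinity>" for n :: nat
      using J by (subst \<mu>) auto
    fix A assume A: "\<And>j. j \<in> insert i J \<Longrightarrow> A j \<in> sets (N j)"
    have Ai[measurable]: "A i \<in> sets (N i)" and Aj[measurable]: "\<And>j. j \<in> J \<Longrightarrow> A j \<in> sets (N j)"
      using A by auto
    have AJ: "Pi\<^sub>E J A \<in> sets (PiM J N)" using J A by (intro sets_PiM_I_finite) auto
    have AS[measurable]: "Pi\<^sub>E (insert i J) A \<in> sets ?P" using J A by (intro sets_PiM_I_finite) auto
    \<comment> \<open>\<open>h\<close> is the candidate posterior times the indicator of the box,
      with the coordinate of \<open>X i\<close> separated from the others so that it can be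
      integrated against a kernel.\<close>
    define h where "h = (\<lambda>(c, x). indicator (A i) c * (ennreal (r y c) *
        (\<Prod>j\<in>J. ennreal (q j y (c, x j) / r y c) * indicator (A j) (x j))))"
    have h: "h \<in> borel_measurable (N i \<Otimes>\<^sub>M PiM J N)"
    proof -
      have [measurable]: "(\<lambda>z. q j y (fst z, snd z j)) \<in> borel_measurable (N i \<Otimes>\<^sub>M PiM J N)" if "j \<in> J" for j
        using that by (intro measurable_compose[OF _ qy(1)[OF that]]) measurable
      show ?thesis unfolding h_def case_prod_beta' by measurable
    qed
    \<comment> \<open>The box is fixed beforehand, so null sets depending on \<open>A j\<close>
      suffice; there are only finitely many \<open>j\<close>.\<close>
    have bayes: "AE c in distr M (N i) (X i). \<forall>j\<in>J.
        ennreal (r y c) * emeasure (L j (c, y)) (A j) = (\<integral>\<^sup>+a\<in>A j. ennreal (q j y (c, a)) \<partial>K j c)"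
      using J A X by (intro AE_ball_countable' AE_cond_law_bayes[OF assms(1) Xi _ Y L K r q y])
        (auto intro: countable_finite)
    have "emeasure M {\<omega> \<in> space M. ?Z \<omega> \<in> Pi\<^sub>E (insert i J) A \<and> Y \<omega> = y}
        = emeasure M {\<omega> \<in> space M. X i \<omega> \<in> A i \<and> (\<lambda>j\<in>J. X j \<omega>) \<in> Pi\<^sub>E J A \<and> Y \<omega> = y}"
      using J by (intro arg_cong[where f="emeasure M"]) (auto simp: PiE_iff)
    \<comment> \<open>Class-conditional independence enters through \<open>LJ\<close>: within class
      \<open>y\<close> the remaining variables have a product law.\<close>
    also have "\<dots> = (\<integral>\<^sup>+c\<in>A i. ennreal (r y c) * emeasure (PiM J (\<lambda>j. L j (c, y))) (Pi\<^sub>E J A) \<partial>distr M (N i) (X i))"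
      by (rule cond_law_class[OF assms(1) Xi XJ Y LJ r y Ai AJ])
    also have "\<dots> = (\<integral>\<^sup>+c. \<integral>\<^sup>+x. h (c, x) \<partial>PiM J (\<lambda>j. K j c) \<partial>distr M (N i) (X i))"
    proof (intro nn_integral_cong_AE)
      show "AE c in distr M (N i) (X i).
          ennreal (r y c) * emeasure (PiM J (\<lambda>j. L j (c, y))) (Pi\<^sub>E J A) * indicator (A i) c
            = (\<integral>\<^sup>+x. h (c, x) \<partial>PiM J (\<lambda>j. K j c))"
        using bayes AE_space
      proof eventually_elim
        case (elim c)
        then have c: "c \<in> space (N i)" by simp
        then have cy: "(c, y) \<in> space (N i \<Otimes>\<^sub>M count_space T)" using y by (simp add: space_pair_measure)
        have sK: "sets (K j c) = sets (N j)" if "j \<in> J" for j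
          by (rule cond_lawD(5)[OF K[OF that] c])
        have sL: "sets (L j (c, y)) = sets (N j)" if "j \<in> J" for j
          by (rule cond_lawD(5)[OF L[OF that] cy])
        have sfK: "sigma_finite_measure (K j c)" if "j \<in> J" for j
          using cond_lawD(4)[OF K[OF that] c]
          by (simp add: prob_space_def finite_measure_def)
        have sfL: "sigma_finite_measure (L j (c, y))" if "j \<in> J" for j
          using cond_lawD(4)[OF L[OF that] cy]
          by (simp add: prob_space_def finite_measure_def)
        have [measurable]: "(\<lambda>a. q j y (c, a)) \<in> borel_measurable (N j)" if "j \<in> J" for j
          using measurable_compose[OF measurable_Pair1'[OF c] qy(1)[OF that]] .
        have fm: "(\<lambda>a. ennreal (q j y (c, a) / r y c) * indicator (A j) a) \<in> borel_measurable (K j c)" if [measurable]: "j \<in> J" for j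
        proof -
          have [measurable]: "indicator (A j) \<in> borel_measurable (N j)" using Aj[OF that] by simp
          show ?thesis
            unfolding measurable_cong_sets[OF sK[OF that] refl] by measurable
        qed
        \<comment> \<open>Bayes' rule divided by \<open>r y c\<close>, which is legitimate where
          that number is positive: \<open>q j / r\<close> is the likelihood ratio between the laws
          \<open>L j\<close> and \<open>K j\<close>.\<close>
        have ratio: "emeasure (L j (c, y)) (A j) = (\<integral>\<^sup>+a\<in>A j. ennreal (q j y (c, a) / r y c) \<partial>K j c)"
          if pos: "0 < r y c" and j: "j \<in> J" for j
        proof -
          have "ennreal (r y c) * (\<integral>\<^sup>+a\<in>A j. ennreal (q j y (c, a) / r y c) \<partial>K j c)
              = (\<integral>\<^sup>+a. ennreal (r y c) * (ennreal (q j y (c, a) / r y c) * indicator (A j) a) \<partial>K j c)"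
            by (rule nn_integral_cmult[symmetric, OF fm[OF j]])
          also have "\<dots> = (\<integral>\<^sup>+a\<in>A j. ennreal (q j y (c, a)) \<partial>K j c)"
            using pos qy(2)[OF j]
            by (intro nn_integral_cong) (auto simp: indicator_def ennreal_mult[symmetric])
          also have "\<dots> = ennreal (r y c) * emeasure (L j (c, y)) (A j)"
            using elim(1) j by simp
          finally show ?thesis
            using pos by (simp add: ennreal_mult_cancel_left)
        qed
        have "ennreal (r y c) * emeasure (PiM J (\<lambda>j. L j (c, y))) (Pi\<^sub>E J A)
            = ennreal (r y c) * (\<Prod>j\<in>J. emeasure (L j (c, y)) (A j))"
          using J A sL sfL by (subst emeasure_PiM_box) auto
        also have "\<dots> = ennreal (r y c) * (\<Prod>j\<in>J. \<integral>\<^sup>+a\<in>A j. ennreal (q j y (c, a) / r y c) \<partial>K j c)"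
        proof (cases "r y c = 0")
          case False
          then have "0 < r y c" using r_nonneg[of c] by simp
          then show ?thesis using ratio by simp
        qed simp
        \<comment> \<open>The product of one-dimensional integrals becomes one integral over the
          product kernel, the form in which \<open>KJ\<close> can be used.\<close>
        also have "\<dots> = ennreal (r y c) * (\<integral>\<^sup>+x. (\<Prod>j\<in>J. ennreal (q j y (c, x j) / r y c) * indicator (A j) (x j)) \<partial>PiM J (\<lambda>j. K j c))"
          using J sfK fm by (subst nn_integral_PiM_prod) auto
        finally have *: "ennreal (r y c) * emeasure (PiM J (\<lambda>j. L j (c, y))) (Pi\<^sub>E J A) = \<dots>" .
        have "(\<lambda>x. \<Prod>j\<in>J. ennreal (q j y (c, x j) / r y c) * indicator (A j) (x j)) \<in> borel_measurable (PiM J (\<lambda>j. K j c))"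
        proof (rule borel_measurable_prod_ennreal)
          fix j assume j: "j \<in> J"
          have "(\<lambda>x. x j) \<in> measurable (PiM J (\<lambda>j. K j c)) (K j c)"
            using j by (rule measurable_component_singleton)
          from measurable_compose[OF this fm[OF j]]
          show "(\<lambda>x. ennreal (q j y (c, x j) / r y c) * indicator (A j) (x j)) \<in> borel_measurable (PiM J (\<lambda>j. K j c))" .
        qed
        then show ?case
          unfolding h_def by (simp add: nn_integral_cmult * mult.commute)
      qed
    qed
    \<comment> \<open>Independence given \<open>X i\<close> alone enters through \<open>KJ\<close>:
      the product kernel is a genuine conditional law, so the iterated integral is an expectation
      over \<open>M\<close>.\<close>
    also have "\<dots> = (\<integral>\<^sup>+\<omega>. h (X i \<omega>, \<lambda>j\<in>J. X j \<omega>) \<partial>M)"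
      by (rule cond_law_nn_integral[OF assms(1) Xi XJ KJ h, symmetric])
    also have "\<dots> = (\<integral>\<^sup>+\<omega>. ennreal (?g y (?Z \<omega>)) * indicator (Pi\<^sub>E (insert i J) A) (?Z \<omega>) \<partial>M)"
    proof (intro nn_integral_cong)
      fix \<omega>
      have *: "(\<lambda>j\<in>insert i J. X j \<omega>) j = X j \<omega>" if "j \<in> insert i J" for j using that by simp
      have "h (X i \<omega>, \<lambda>j\<in>J. X j \<omega>) = indicator (A i) (X i \<omega>) * (ennreal (r y (X i \<omega>)) *
          ((\<Prod>j\<in>J. ennreal (q j y (X i \<omega>, X j \<omega>) / r y (X i \<omega>))) * (\<Prod>j\<in>J. indicator (A j) (X j \<omega>))))"
        unfolding h_def by (simp add: prod.distrib)
      also have "(\<Prod>j\<in>J. ennreal (q j y (X i \<omega>, X j \<omega>) / r y (X i \<omega>)))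
          = ennreal (\<Prod>j\<in>J. q j y (X i \<omega>, X j \<omega>) / r y (X i \<omega>))"
        using qy(2) r_nonneg by (intro prod_ennreal) auto
      also have "(\<Prod>j\<in>J. indicator (A j) (X j \<omega>)) = (indicator {x. \<forall>j\<in>J. X j x \<in> A j} \<omega> :: ennreal)"
        using J(1) by (induction J) (auto simp: indicator_def)
      also have "indicator (A i) (X i \<omega>) * (ennreal (r y (X i \<omega>)) *
          (ennreal (\<Prod>j\<in>J. q j y (X i \<omega>, X j \<omega>) / r y (X i \<omega>)) * indicator {x. \<forall>j\<in>J. X j x \<in> A j} \<omega>))
          = ennreal (r y (X i \<omega>)) * ennreal (\<Prod>j\<in>J. q j y (X i \<omega>, X j \<omega>) / r y (X i \<omega>))
            * indicator (Pi\<^sub>E (insert i J) A) (?Z \<omega>)"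
        by (auto simp: indicator_def PiE_iff)
      also have "ennreal (r y (X i \<omega>)) * ennreal (\<Prod>j\<in>J. q j y (X i \<omega>, X j \<omega>) / r y (X i \<omega>)) = ennreal (?g y (?Z \<omega>))"
        using qy(2) r_nonneg
        by (subst ennreal_mult[symmetric]) (auto intro!: prod_nonneg arg_cong[where f=ennreal] prod.cong)
      finally show "h (X i \<omega>, \<lambda>j\<in>J. X j \<omega>) = ennreal (?g y (?Z \<omega>)) * indicator (Pi\<^sub>E (insert i J) A) (?Z \<omega>)" .
    qed
    also have "\<dots> = (\<integral>\<^sup>+x\<in>Pi\<^sub>E (insert i J) A. ennreal (?g y x) \<partial>distr M ?P ?Z)"
      by (rule nn_integral_distr[symmetric, OF Z, of "\<lambda>x. ennreal (?g y x) * indicator (Pi\<^sub>E (insert i J) A) x"]) measurable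
    finally show "emeasure \<mu> (Pi\<^sub>E (insert i J) A) = emeasure \<nu> (Pi\<^sub>E (insert i J) A)"
      unfolding \<mu>[OF AS] \<nu>[OF AS] .
  qed
  then show "emeasure M {\<omega> \<in> space M. ?Z \<omega> \<in> B \<and> Y \<omega> = y} = (\<integral>\<^sup>+x\<in>B. ennreal (?g y x) \<partial>distr M ?P ?Z)"
    if "B \<in> sets ?P" for B
    unfolding \<mu>[OF that, symmetric] \<nu>[OF that, symmetric] by simp
qed

theorem mainTheorem2:
  fixes M :: "'a measure" and b :: real
    and X :: "nat \<Rightarrow> 'a \<Rightarrow> real" and Y :: "'a \<Rightarrow> nat"
    and n c k i :: nat and S :: "nat set"
  assumes "prob_space M" and "1 < b"
    and "\<forall>j\<in>{1..n}. X j \<in> borel_measurable M"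
    and "\<forall>j\<in>{1..n}. continuous_on UNIV (cdf (distr M borel (X j)))"
    and "Y \<in> measurable M (count_space {1..c})"
    and "S \<subseteq> {1..n}" and "card S = k" and "1 \<le> k" and "k \<le> n" and "i \<in> S"
    and "cond_indep_vars M (\<lambda>_. borel) X (S - {i}) borel (X i)"
    and "cond_indep_vars M (\<lambda>_. borel) X (S - {i})
           (borel \<Otimes>\<^sub>M count_space {1..c}) (\<lambda>\<omega>. (X i \<omega>, Y \<omega>))"
  shows "prob_space.mutual_information M b (PiM S (\<lambda>_. borel)) (count_space {1..c})
             (\<lambda>\<omega>. \<lambda>j\<in>S. X j \<omega>) Y
         = prob_space.mutual_information M b borel (count_space {1..c}) (X i) Y
           + (\<Sum>j\<in>S - {i}. cond_mutual_info b M borel (count_space {1..c}) borel (X j) Y (X i))"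
proof -
  note prob = \<open>prob_space M\<close> and b = \<open>1 < b\<close> and Y = \<open>Y \<in> measurable M (count_space {1..c})\<close>
  let ?T = "{1..c}" and ?J = "S - {i}"
  have T: "finite ?T" by simp
  have X: "X j \<in> borel_measurable M" if "j \<in> S" for j
    using that assms by blast
  have S: "insert i ?J = S" using \<open>i \<in> S\<close> by blast
  have J: "finite ?J" "i \<notin> ?J"
    using finite_subset[OF \<open>S \<subseteq> {1..n}\<close>] by auto
  have Xi[measurable]: "X i \<in> borel_measurable M" using X \<open>i \<in> S\<close> .
  have Xj[measurable]: "X j \<in> borel_measurable M" if "j \<in> ?J" for j using X that by simp
  obtain K where K: "\<And>j. j \<in> ?J \<Longrightarrow> cond_law M borel (X j) borel (X i) (K j)"
    and KJ: "cond_law M (PiM ?J (\<lambda>_. borel)) (\<lambda>\<omega>. \<lambda>j\<in>?J. X j \<omega>) borel (X i) (\<lambda>c. PiM ?J (\<lambda>j. K j c))"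
    using assms(11) unfolding cond_indep_vars_def by blast
  obtain L where L: "\<And>j. j \<in> ?J \<Longrightarrow> cond_law M borel (X j) (borel \<Otimes>\<^sub>M count_space ?T) (\<lambda>\<omega>. (X i \<omega>, Y \<omega>)) (L j)"
    and LJ: "cond_law M (PiM ?J (\<lambda>_. borel)) (\<lambda>\<omega>. \<lambda>j\<in>?J. X j \<omega>) (borel \<Otimes>\<^sub>M count_space ?T)
      (\<lambda>\<omega>. (X i \<omega>, Y \<omega>)) (\<lambda>c. PiM ?J (\<lambda>j. L j c))"
    using assms(12) unfolding cond_indep_vars_def by blast
  obtain r where r: "posterior M borel (X i) ?T Y r"
    using posterior_exists[OF prob Xi Y] .
  have pair: "(\<lambda>\<omega>. (X i \<omega>, X j \<omega>)) \<in> measurable M (borel \<Otimes>\<^sub>M borel)" if "j \<in> ?J" for j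
    using that by measurable
  have "\<exists>q. posterior M (borel \<Otimes>\<^sub>M borel) (\<lambda>\<omega>. (X i \<omega>, X j \<omega>)) ?T Y q" if "j \<in> ?J" for j
    using posterior_exists[OF prob pair[OF that] Y] by blast
  then obtain q where q: "\<And>j. j \<in> ?J \<Longrightarrow> posterior M (borel \<Otimes>\<^sub>M borel) (\<lambda>\<omega>. (X i \<omega>, X j \<omega>)) ?T Y (q j)"
    by metis
  let ?XS = "\<lambda>\<omega>. \<lambda>j\<in>S. X j \<omega>"
  define g where "g = (\<lambda>y x. r y (x i) * (\<Prod>j\<in>?J. q j y (x i, x j) / r y (x i)))"
  have XS: "?XS \<in> measurable M (PiM S (\<lambda>_. borel))"
    by (intro measurable_restrict X)
  have g: "posterior M (PiM S (\<lambda>_. borel)) ?XS ?T Y g"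
    using posterior_cond_indep[OF prob J, of X "\<lambda>_. borel" Y ?T K L r q] X Y K KJ L LJ r q
    unfolding S g_def by blast
  define p where "p = (\<lambda>y. measure M {\<omega> \<in> space M. Y \<omega> = y})"
  have int_r: "integrable M (\<lambda>\<omega>. log b (r (Y \<omega>) (X i \<omega>)))"
    by (rule posterior_integrable_log[OF prob Xi Y T r b])
  have int_p: "integrable M (\<lambda>\<omega>. log b (p (Y \<omega>)))"
    unfolding p_def by (rule integrable_log_class_prob[OF prob Xi Y T r b])
  have int_q: "integrable M (\<lambda>\<omega>. log b (q j (Y \<omega>) (X i \<omega>, X j \<omega>)))" if "j \<in> ?J" for j
    by (rule posterior_integrable_log[OF prob pair[OF that] Y T q[OF that] b])
  have int_qr: "integrable M (\<lambda>\<omega>. log b (q j (Y \<omega>) (X i \<omega>, X j \<omega>)) - log b (r (Y \<omega>) (X i \<omega>)))" if "j \<in> ?J" for j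
    by (intro Bochner_Integration.integrable_diff int_q[OF that] int_r)
  have int_rp: "integrable M (\<lambda>\<omega>. log b (r (Y \<omega>) (X i \<omega>)) - log b (p (Y \<omega>)))"
    by (intro Bochner_Integration.integrable_diff int_r int_p)
  have int_sum: "integrable M (\<lambda>\<omega>. \<Sum>j\<in>?J. log b (q j (Y \<omega>) (X i \<omega>, X j \<omega>)) - log b (r (Y \<omega>) (X i \<omega>)))"
    by (intro Bochner_Integration.integrable_sum int_qr)
  have int_g: "integrable M (\<lambda>\<omega>. log b (g (Y \<omega>) (?XS \<omega>)))"
    by (rule posterior_integrable_log[OF prob XS Y T g b])
  \<comment> \<open>Positivity at the realised class, simultaneously for the finitely many
    \<open>j\<close>, keeps every quotient \<open>Q j / R\<close> below positive, so that its
    logarithm splits.\<close>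
  have "AE \<omega> in M. \<forall>j\<in>?J. 0 < q j (Y \<omega>) (X i \<omega>, X j \<omega>)"
    using J posterior_pos[OF prob pair Y T q] by (intro AE_ball_countable') (auto intro: countable_finite)
  then have log_g: "AE \<omega> in M. log b (g (Y \<omega>) (?XS \<omega>)) - log b (p (Y \<omega>))
      = (log b (r (Y \<omega>) (X i \<omega>)) - log b (p (Y \<omega>)))
        + (\<Sum>j\<in>?J. log b (q j (Y \<omega>) (X i \<omega>, X j \<omega>)) - log b (r (Y \<omega>) (X i \<omega>)))"
    using posterior_pos[OF prob Xi Y T r]
  proof eventually_elim
    case (elim \<omega>)
    define R where "R = r (Y \<omega>) (X i \<omega>)"
    define Q where "Q = (\<lambda>j. q j (Y \<omega>) (X i \<omega>, X j \<omega>))"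
    have pos: "0 < R" "\<And>j. j \<in> ?J \<Longrightarrow> 0 < Q j" using elim by (auto simp: R_def Q_def)
    have "g (Y \<omega>) (?XS \<omega>) = R * (\<Prod>j\<in>?J. Q j / R)"
      using \<open>i \<in> S\<close> by (simp add: g_def R_def Q_def)
    \<comment> \<open>The identity is established for \<open>ln\<close>; dividing by
      \<open>ln b\<close>, term by term in the sum, gives it for \<open>log b\<close>.\<close>
    moreover have "ln (R * (\<Prod>j\<in>?J. Q j / R)) = ln R + (\<Sum>j\<in>?J. ln (Q j) - ln R)"
    proof -
      have "ln (\<Prod>j\<in>?J. Q j / R) = (\<Sum>j\<in>?J. ln (Q j / R))"
      proof (rule ln_prod[OF J(1)])
        show "Q j / R \<noteq> 0" if "j \<in> ?J" for j using pos(1) pos(2)[OF that] by simp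
      qed
      also have "\<dots> = (\<Sum>j\<in>?J. ln (Q j) - ln R)"
        using pos by (intro sum.cong refl ln_divide_pos) auto
      finally have ln_P: "ln (\<Prod>j\<in>?J. Q j / R) = (\<Sum>j\<in>?J. ln (Q j) - ln R)" .
      have "0 < (\<Prod>j\<in>?J. Q j / R)"
        using pos by (intro prod_pos divide_pos_pos) auto
      then show ?thesis by (simp only: ln_mult_pos[OF pos(1)] ln_P)
    qed
    ultimately have "log b (g (Y \<omega>) (?XS \<omega>)) = log b R + (\<Sum>j\<in>?J. log b (Q j) - log b R)"
      by (simp add: log_def add_divide_distrib sum_divide_distrib diff_divide_distrib)
    then show ?case by (simp add: R_def Q_def)
  qed
  have "prob_space.mutual_information M b (PiM S (\<lambda>_. borel)) (count_space ?T) ?XS Y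
      = (\<integral>\<omega>. log b (g (Y \<omega>) (?XS \<omega>)) - log b (p (Y \<omega>)) \<partial>M)"
    unfolding p_def by (rule mutual_information_posterior[OF prob XS Y T g b])
  also have "\<dots> = (\<integral>\<omega>. (log b (r (Y \<omega>) (X i \<omega>)) - log b (p (Y \<omega>)))
        + (\<Sum>j\<in>?J. log b (q j (Y \<omega>) (X i \<omega>, X j \<omega>)) - log b (r (Y \<omega>) (X i \<omega>))) \<partial>M)"
    by (intro integral_cong_AE log_g borel_measurable_integrable Bochner_Integration.integrable_add
        Bochner_Integration.integrable_diff[OF int_g int_p] int_rp int_sum)
  \<comment> \<open>Splitting is allowed because each information term has an integrable integrand
    of its own.\<close>
  also have "\<dots> = (\<integral>\<omega>. log b (r (Y \<omega>) (X i \<omega>)) - log b (p (Y \<omega>)) \<partial>M)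
        + (\<Sum>j\<in>?J. \<integral>\<omega>. log b (q j (Y \<omega>) (X i \<omega>, X j \<omega>)) - log b (r (Y \<omega>) (X i \<omega>)) \<partial>M)"
    unfolding Bochner_Integration.integral_add[OF int_rp int_sum]
    by (simp only: Bochner_Integration.integral_sum[OF int_qr])
  also have "(\<integral>\<omega>. log b (r (Y \<omega>) (X i \<omega>)) - log b (p (Y \<omega>)) \<partial>M)
      = prob_space.mutual_information M b borel (count_space ?T) (X i) Y"
    unfolding p_def by (rule mutual_information_posterior[OF prob Xi Y T r b, symmetric])
  also have "(\<Sum>j\<in>?J. \<integral>\<omega>. log b (q j (Y \<omega>) (X i \<omega>, X j \<omega>)) - log b (r (Y \<omega>) (X i \<omega>)) \<partial>M)
      = (\<Sum>j\<in>?J. cond_mutual_info b M borel (count_space ?T) borel (X j) Y (X i))"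
    \<comment> \<open>The conditional law of \<open>X j\<close> and \<open>Y\<close> given
      \<open>X i\<close>, whose existence makes the \<open>SOME\<close> in
      \<open>cond_mutual_info\<close> meaningful, is assembled from the class-conditional kernel
      \<open>L j\<close>.\<close>
    by (intro sum.cong refl cond_mutual_info_posterior[OF prob Xi _ Y T b _ q r, symmetric]
        cond_law_pair_exists[OF prob Xi _ Y T L] Xj)
  finally show ?thesis .
qed

end
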